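(* There is a deterministic distributed algorithm (in the LOCAL model) of round complexity $O(\Delta^2\log^3 n)$ that, given any $n$-vertex graph $G$ of maximum degree $\Delta\ge 3$ and any $\Delta$-list-assignment $L$ for the vertices of $G$, either finds an $L$-list-coloring of $G$, or finds that no such coloring exists.
   Context: Graphs are finite and simple. A coloring assigns colors to vertices so that adjacent vertices get different colors. A $k$-list-assignment is a family of lists of colors $(L(v))_{v\in G}$ with $|L(v)|\ge k$ for every vertex $v$; an $L$-list-coloring of $G$ is a coloring $c$ with $c(v)\in L(v)$ for every vertex $v$. LOCAL model: each node of an $n$-vertex graph $G$ has a unique identifier (an integer between $1$ and $n$) and exchanges messages with its neighbors in synchronous rounds. There is no bound on message size and nodes have infinite computational power. Initially each node knows only its own identifier, the number $n$ of vertices, the integer $\Delta$, and its own list of colors. At the end each vertex must output its own color. The round complexity is the number of rounds until every vertex has chosen its output; with round complexity $r$, the output of each vertex depends only on the labelled ball of radius $r$ around it. *)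

theory Defs
  imports Complex_Main "HOL-Library.Multiset" "Graph_Theory.Pair_Digraph"
begin

section \<open>Graphs and list colorings\<close>

text \<open>
  A finite simple graph is a \<^locale>\<open>pair_graph\<close>: each edge is represented by its two orientations,
  so the degree of a vertex is its out-degree.
\<close>

definition max_degree :: "'v pair_pre_digraph \<Rightarrow> nat" where
  "max_degree G = Max (out_degree (with_proj G) ` pverts G)"

definition proper_coloring :: "'v pair_pre_digraph \<Rightarrow> ('v \<Rightarrow> 'c) \<Rightarrow> bool" where
  "proper_coloring G c \<longleftrightarrow> (\<forall>(u, v) \<in> parcs G. c u \<noteq> c v)"

text \<open>The first disjunct is needed because the library's \<^const>\<open>card\<close> is 0 on infinite sets.\<close>

definition list_assignment :: "'v pair_pre_digraph \<Rightarrow> nat \<Rightarrow> ('v \<Rightarrow> 'c set) \<Rightarrow> bool" where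
  "list_assignment G k L \<longleftrightarrow> (\<forall>v \<in> pverts G. infinite (L v) \<or> k \<le> card (L v))"

definition list_coloring :: "'v pair_pre_digraph \<Rightarrow> ('v \<Rightarrow> 'c set) \<Rightarrow> ('v \<Rightarrow> 'c) \<Rightarrow> bool" where
  "list_coloring G L c \<longleftrightarrow> proper_coloring G c \<and> (\<forall>v \<in> pverts G. c v \<in> L v)"


section \<open>The LOCAL model\<close>

definition unique_identifiers :: "'v pair_pre_digraph \<Rightarrow> ('v \<Rightarrow> nat) \<Rightarrow> bool" where
  "unique_identifiers G ident \<longleftrightarrow>
     inj_on ident (pverts G) \<and> ident ` pverts G \<subseteq> {1..card (pverts G)}"

text \<open>
  A deterministic algorithm, run by every node, with states \<open>'s\<close>, messages \<open>'m\<close>, private inputs \<open>'i\<close>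
  and outputs \<open>'o\<close>. The arguments of \<open>init\<close> are the identifier of the node, the number of vertices,
  the maximum degree and the private input. In a round each node sends one message to all its
  neighbors and receives the multiset of their messages. Since messages are unbounded, a message for
  a particular neighbor can be sent by naming the addressee in it. The functions are arbitrary, so
  nodes have unlimited computational power.
\<close>

record ('s, 'm, 'i, 'o) local_algorithm =
  init :: "nat \<Rightarrow> nat \<Rightarrow> nat \<Rightarrow> 'i \<Rightarrow> 's"
  message :: "'s \<Rightarrow> 'm"
  update :: "'s \<Rightarrow> 'm multiset \<Rightarrow> 's"
  decision :: "'s \<Rightarrow> 'o option"

text \<open>The state of a node after a number of rounds.\<close>

primrec node_state ::
  "('s, 'm, 'i, 'o) local_algorithm \<Rightarrow> 'v pair_pre_digraph \<Rightarrow> ('v \<Rightarrow> nat) \<Rightarrow> ('v \<Rightarrow> 'i) \<Rightarrow> nat \<Rightarrow> 'v \<Rightarrow> 's"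
where
  "node_state A G ident inp 0 v = init A (ident v) (card (pverts G)) (max_degree G) (inp v)"
| "node_state A G ident inp (Suc t) v =
     update A (node_state A G ident inp t v)
       (image_mset (\<lambda>u. message A (node_state A G ident inp t u)) (mset_set {u. (v, u) \<in> parcs G}))"

definition all_decided_within ::
  "('s, 'm, 'i, 'o) local_algorithm \<Rightarrow> 'v pair_pre_digraph \<Rightarrow> ('v \<Rightarrow> nat) \<Rightarrow> ('v \<Rightarrow> 'i) \<Rightarrow> nat \<Rightarrow> bool"
where
  "all_decided_within A G ident inp r \<longleftrightarrow>
     (\<forall>v \<in> pverts G. \<exists>t \<le> r. decision A (node_state A G ident inp t v) \<noteq> None)"

text \<open>
  The first decision of a node is final, although the node keeps taking part in the communication.
  The value is only meaningful for nodes that decide at some time.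
\<close>

definition node_output ::
  "('s, 'm, 'i, 'o) local_algorithm \<Rightarrow> 'v pair_pre_digraph \<Rightarrow> ('v \<Rightarrow> nat) \<Rightarrow> ('v \<Rightarrow> 'i) \<Rightarrow> 'v \<Rightarrow> 'o"
where
  "node_output A G ident inp v =
     the (decision A (node_state A G ident inp
       (LEAST t. decision A (node_state A G ident inp t v) \<noteq> None) v))"

text \<open>
  HOL cannot quantify existentially over the types of states and messages, so one type is fixed for
  both. It loses no generality: whatever a node can learn in finitely many rounds is a finite tree
  of numbers and lists of colors (its own initial knowledge and, recursively, that of its neighbors),
  and every such tree is a value of this type.
\<close>

datatype 'c knowledge =
  Number nat
| Palette "'c set"
| Tree "'c knowledge list"


section \<open>Distributed list coloring\<close>

datatype 'c answer = Color 'c | No_Coloring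

text \<open>
  If there is no list coloring, all vertices of some connected component have to say so (hence all
  vertices of \<open>G\<close> if \<open>G\<close> is connected). This cannot be asked of every component, as no information
  passes between components.
\<close>

definition solves_list_coloring ::
  "'v pair_pre_digraph \<Rightarrow> ('v \<Rightarrow> 'c set) \<Rightarrow> ('v \<Rightarrow> 'c answer) \<Rightarrow> bool"
where
  "solves_list_coloring G L out \<longleftrightarrow>
     (\<exists>c. list_coloring G L c \<and> (\<forall>v \<in> pverts G. out v = Color (c v))) \<or>
     ((\<nexists>c. list_coloring G L c) \<and>
      (\<exists>v \<in> pverts G. \<forall>u. v \<rightarrow>\<^sup>*\<^bsub>with_proj G\<^esub> u \<longrightarrow> out u = No_Coloring))"

end

theory Submission
  imports Defs
begin

text \<open>
  Let \<open>R\<close> be of order \<open>log n\<close>. Splitting the identifiers bit by bit yields a \<open>(\<Delta> + 1)\<close>-coloring and a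
  set of roots with pairwise distance more than \<open>2 R + 1\<close> such that every vertex is within distance
  \<open>O(R log n)\<close> of a root. Coloring greedily in order of decreasing distance to the roots, class by
  class of the \<open>(\<Delta> + 1)\<close>-coloring, never gets stuck before the roots, because every other vertex has a
  later neighbor. This takes \<open>O(\<Delta> log\<^sup>2 n)\<close> rounds. Finally each root tries to recolor its ball of radius
  \<open>R\<close>, and these balls do not interact.

  Suppose that such a ball cannot be recolored. Then the uncolored vertex can be moved like a token
  to every vertex of the ball, all vertices have degree \<open>\<Delta>\<close>, and the colors around the token are
  always exactly the available ones. Moving the token around a cycle shows that no cycle of even
  length has a vertex without chords. Hence in the distance layers around the root parents are
  unique, and the sizes of the layers double every two steps unless the ball is a whole component
  (a clique). As \<open>2 ^ (R div 2) > n\<close>, the ball is a component and then its vertices may answer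
  that there is no coloring.
\<close>

section \<open>Balls and moving the uncolored vertex\<close>

text \<open>The recursion peels off the first step of a walk, because the locality inductions pass
  from a vertex to its neighbors. \<open>nball_SucE\<close> peels off the last step.\<close>

primrec nball :: "('a \<Rightarrow> 'a set) \<Rightarrow> nat \<Rightarrow> 'a \<Rightarrow> 'a set" where
  "nball N 0 v = {v}"
| "nball N (Suc r) v = insert v (\<Union>u\<in>N v. nball N r u)"

lemma center_in_nball [simp]: "v \<in> nball N r v"
  by (cases r) auto

lemma nball_add: "u \<in> nball N a v \<Longrightarrow> w \<in> nball N b u \<Longrightarrow> w \<in> nball N (a + b) v"
proof (induction a arbitrary: v)
  case 0
  then show ?case by simp
next
  case (Suc a)
  show ?case
  proof (cases "u = v")
    case True
    have "w \<in> nball N b v \<Longrightarrow> w \<in> nball N (b + k) v" for k v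
    proof (induction b arbitrary: v)
      case 0
      then show ?case by simp
    qed auto
    with True Suc.prems show ?thesis by (metis add.commute)
  next
    case False
    with Suc show ?thesis by auto
  qed
qed

lemma nball_mono: "a \<le> b \<Longrightarrow> nball N a v \<subseteq> nball N b v"
  using nball_add[of v N "b - a" v _ a] by auto

lemma nbr_in_nball: "u \<in> nball N r v \<Longrightarrow> w \<in> N u \<Longrightarrow> w \<in> nball N (Suc r) v"
  using nball_add[of u N r v w 1] by auto

lemma nball_SucE:
  assumes "w \<in> nball N (Suc r) v"
  obtains "w \<in> nball N r v" | u where "u \<in> nball N r v" "w \<in> N u"
proof -
  have "w \<in> nball N r v \<or> (\<exists>u\<in>nball N r v. w \<in> N u)"
    using assms
  proof (induction r arbitrary: v)
    case (Suc r)
    show ?case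
    proof (cases "w = v")
      case False
      then obtain x where "x \<in> N v" "w \<in> nball N (Suc r) x"
        using Suc.prems by auto
      with Suc.IH[of x] show ?thesis by auto
    qed auto
  qed auto
  with that show thesis by blast
qed

lemma nball_closed:
  assumes "\<And>x. x \<in> A \<Longrightarrow> N x \<subseteq> A" "v \<in> A"
  shows "nball N r v \<subseteq> A"
  using assms by (induction r arbitrary: v) auto

declare nball.simps(2) [simp del]

locale nbr_graph =
  fixes N :: "'a \<Rightarrow> 'a set" and V :: "'a set" and d :: nat
  assumes finV: "finite V"
    and nbr_sub: "N x \<subseteq> V"
    and nbr_sym: "x \<in> N y \<Longrightarrow> y \<in> N x"
    and nbr_irrefl: "x \<notin> N x"
    and deg: "card (N x) \<le> d"
begin

lemma finN [simp]: "finite (N x)"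
  using finite_subset[OF nbr_sub finV] .

lemma nball_sym: "u \<in> nball N r v \<Longrightarrow> v \<in> nball N r u"
proof (induction r arbitrary: v)
  case (Suc r)
  show ?case
  proof (cases "u = v")
    case False
    then obtain x where "x \<in> N v" "u \<in> nball N r x"
      using Suc.prems by (auto simp: nball.simps(2))
    with Suc.IH nbr_in_nball nbr_sym show ?thesis by metis
  qed auto
qed auto

end

text \<open>The situation to be refuted for large \<open>R\<close>: \<open>v\<close> is an uncolored
  root, \<open>c0\<close> colors the rest of its ball, and \<open>L\<close> holds the colors left
  over by neighbors outside. Each outside neighbor removes at most one color, which explains the
  second summand in \<open>lists\<close>.\<close>

locale stuck_ball = nbr_graph +
  fixes L :: "'a \<Rightarrow> 'c set" and c0 :: "'a \<Rightarrow> 'c" and v :: 'a and R :: nat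
  assumes d3: "3 \<le> d" and vV: "v \<in> V"
    and lists: "x \<in> nball N R v \<Longrightarrow> finite (L x) \<Longrightarrow> d \<le> card (L x) + card (N x - nball N R v)"
    and start: "x \<in> nball N R v - {v} \<Longrightarrow> c0 x \<in> L x"
      "x \<in> nball N R v - {v} \<Longrightarrow> y \<in> N x \<inter> nball N R v - {v} \<Longrightarrow> c0 x \<noteq> c0 y"
    and stuck: "\<nexists>f. \<forall>x\<in>nball N R v. f x \<in> L x \<and> (\<forall>y\<in>N x \<inter> nball N R v. f x \<noteq> f y)"
    and not_closed: "\<not> (\<forall>x\<in>nball N R v. N x \<subseteq> nball N R v)"
    and R2: "2 \<le> R"
begin

abbreviation B where "B \<equiv> nball N R v"

text \<open>
  The vertex \<open>x\<close> with the token is the only uncolored one: the value \<open>c x\<close> is irrelevant.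
\<close>

definition token :: "'a \<Rightarrow> ('a \<Rightarrow> 'c) \<Rightarrow> bool" where
  "token x c \<longleftrightarrow> x \<in> B \<and> (\<forall>y\<in>B - {x}. c y \<in> L y \<and> (\<forall>z\<in>N y \<inter> B - {x}. c y \<noteq> c z))"

text \<open>A color of \<open>L x\<close> missing among the neighbors of \<open>x\<close> in the
  ball could be given to \<open>x\<close>, completing a coloring of the ball. Hence
  \<open>d <= card (L x) + card (N x - B) <= card (N x) <= d\<close>, with equality
  throughout.\<close>

lemma token_tight:
  assumes "token x c"
  shows "inj_on c (N x \<inter> B)" "c ` (N x \<inter> B) = L x" "card (N x) = d"
proof -
  have xB: "x \<in> B" using assms by (simp add: token_def)
  have sub: "L x \<subseteq> c ` (N x \<inter> B)"
  proof
    fix a assume a: "a \<in> L x"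
    show "a \<in> c ` (N x \<inter> B)"
    proof (rule ccontr)
      assume na: "a \<notin> c ` (N x \<inter> B)"
      have "\<forall>y\<in>B. (c(x := a)) y \<in> L y \<and> (\<forall>z\<in>N y \<inter> B. (c(x := a)) y \<noteq> (c(x := a)) z)"
        using assms na a nbr_sym nbr_irrefl unfolding token_def by (auto; blast)
      then show False using stuck by blast
    qed
  qed
  have fin: "finite (N x \<inter> B)" by simp
  have "card (N x) = card (N x \<inter> B) + card (N x - B)"
    by (subst card_Int_Diff[of "N x" B]) auto
  moreover have "d \<le> card (L x) + card (N x - B)"
    using lists[OF xB] finite_subset[OF sub] by auto
  moreover have "card (L x) \<le> card (c ` (N x \<inter> B))" by (rule card_mono) (use sub in auto)
  moreover have "card (c ` (N x \<inter> B)) \<le> card (N x \<inter> B)" by (rule card_image_le) simp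
  moreover note deg[of x]
  ultimately have eq: "card (c ` (N x \<inter> B)) = card (N x \<inter> B)" "card (L x) = card (c ` (N x \<inter> B))"
    "card (N x) = d" by linarith+
  show "card (N x) = d" by fact
  show "inj_on c (N x \<inter> B)" using eq(1) eq_card_imp_inj_on[OF fin] by blast
  show "c ` (N x \<inter> B) = L x" using card_subset_eq[OF _ sub] eq(2) by auto
qed

text \<open>By \<open>token_tight\<close> the color of \<open>y\<close> is available at
  \<open>x\<close> and occurs at no other neighbor of \<open>x\<close> in the ball, so
  \<open>x\<close> can take it over.\<close>

lemma token_move:
  assumes t: "token x c" and y: "y \<in> N x" "y \<in> B"
  shows "token y (c(x := c y))"
proof -
  have inj: "inj_on c (N x \<inter> B)" and im: "c ` (N x \<inter> B) = L x"
    using token_tight[OF t] by auto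
  have 1: "c y \<in> L x" using im y by blast
  have 2: "c y \<noteq> c z" if "z \<in> N x \<inter> B" "z \<noteq> y" for z
    using inj that y by (auto dest: inj_onD)
  show ?thesis using t y 1 2 nbr_sym nbr_irrefl unfolding token_def
    by (auto; metis)
qed

lemma token_exists: "x \<in> B \<Longrightarrow> \<exists>c. token x c"
proof -
  have "\<exists>c. token x c" if "k \<le> R" "x \<in> nball N k v" for k x
    using that
  proof (induction k arbitrary: x)
    case 0
    then show ?case using start unfolding token_def by (intro exI[of _ c0]) auto
  next
    case (Suc k)
    from Suc.prems(2) show ?case
    proof (cases rule: nball_SucE)
      case 1
      with Suc show ?thesis by auto
    next
      case (2 u)
      with Suc obtain c where "token u c" by auto
      with 2 token_move[of u c x] Suc.prems nball_mono[of "Suc k" R N v] show ?thesis by blast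
    qed
  qed
  then show "x \<in> B \<Longrightarrow> \<exists>c. token x c" by blast
qed

lemma full_degree: "x \<in> B \<Longrightarrow> card (N x) = d"
  using token_exists token_tight by blast

lemma token_rotate:
  assumes t: "token (y 0) c" and k: "k \<ge> 2"
    and inj: "inj_on y {..k}" and yB: "y ` {..k} \<subseteq> B"
    and adj: "\<And>i. i < k \<Longrightarrow> y (Suc i) \<in> N (y i)" and last: "y k \<in> N (y 0)"
  shows "\<exists>c'. token (y 0) c' \<and> (\<forall>i. 1 \<le> i \<and> i < k \<longrightarrow> c' (y i) = c (y (Suc i))) \<and>
    c' (y k) = c (y 1) \<and> (\<forall>z. z \<notin> y ` {..k} \<longrightarrow> c' z = c z)"
proof -
  have "j \<le> k \<Longrightarrow> \<exists>c'. token (y j) c' \<and> (\<forall>i<j. c' (y i) = c (y (Suc i))) \<and>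
      (\<forall>z. z \<notin> y ` {..<j} \<longrightarrow> c' z = c z)" for j
  proof (induction j)
    case 0
    then show ?case using t by auto
  next
    case (Suc j)
    then obtain c' where c': "token (y j) c'" "\<forall>i<j. c' (y i) = c (y (Suc i))"
      "\<forall>z. z \<notin> y ` {..<j} \<longrightarrow> c' z = c z" by auto
    have new: "y (Suc j) \<notin> y ` {..<j}"
      using inj Suc.prems by (auto dest!: inj_onD[of y "{..k}"])
    have ne: "y i \<noteq> y j" if "i < j" for i
      using inj Suc.prems that by (auto dest!: inj_onD[of y "{..k}"])
    have "token (y (Suc j)) (c'(y j := c' (y (Suc j))))"
      using Suc.prems yB adj[of j] by (intro token_move[OF c'(1)]) auto
    moreover have "\<forall>i<Suc j. (c'(y j := c' (y (Suc j)))) (y i) = c (y (Suc i))"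
      using c' new ne by (auto simp: less_Suc_eq)
    moreover have "\<forall>z. z \<notin> y ` {..<Suc j} \<longrightarrow> (c'(y j := c' (y (Suc j)))) z = c z"
      using c' by (auto simp: lessThan_Suc)
    ultimately show ?case by blast
  qed
  from this[of k] obtain c' where c': "token (y k) c'" "\<forall>i<k. c' (y i) = c (y (Suc i))"
      "\<forall>z. z \<notin> y ` {..<k} \<longrightarrow> c' z = c z" by auto
  \<comment> \<open>The closing move goes from \<open>y k\<close> to \<open>y 0\<close>, which by
    now carries the old color of \<open>y 1\<close>; so \<open>y k\<close> receives that
    color.\<close>
  show ?thesis
  proof (intro exI[of _ "c'(y k := c' (y 0))"] conjI allI impI)
    show "token (y 0) (c'(y k := c' (y 0)))"
      using yB last nbr_sym by (intro token_move[OF c'(1)]) auto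
    show "(c'(y k := c' (y 0))) (y k) = c (y 1)" using c' k by simp
    show "(c'(y k := c' (y 0))) (y i) = c (y (Suc i))" if "1 \<le> i \<and> i < k" for i
      using c' that inj by (auto dest: inj_onD)
    show "(c'(y k := c' (y 0))) z = c z" if "z \<notin> y ` {..k}" for z
    proof -
      have "z \<notin> y ` {..<k}" "z \<noteq> y k" using that by auto
      then show ?thesis using c' by simp
    qed
  qed
qed

text \<open>
  Moving the token once around the cycle rotates the colors of its other vertices. The rotation
  keeps the set of colors around the chordless vertex, which forces the colors on the cycle to
  alternate; on a cycle of even length the number of colored vertices is odd.
\<close>

lemma no_even_cycle:
  assumes k: "odd k" "k \<ge> 3"
    and inj: "inj_on y {..k}" and yB: "y ` {..k} \<subseteq> B"
    and adj: "\<And>i. i < k \<Longrightarrow> y (Suc i) \<in> N (y i)" and last: "y k \<in> N (y 0)"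
    and chord: "N (y 0) \<inter> y ` {..k} \<subseteq> {y 1, y k}"
  shows False
proof -
  have k2: "2 \<le> k" using k by simp
  have y0: "y 0 \<in> B" using yB by auto
  have y_eq: "y i = y j \<longleftrightarrow> i = j" if "i \<le> k" "j \<le> k" for i j
    using inj that by (auto dest: inj_onD)
  \<comment> \<open>Before and after a rotation the colors around \<open>y 0\<close> form
    \<open>L (y 0)\<close>. Only \<open>y 1\<close> and \<open>y k\<close> changed, to the old
    colors of \<open>y 2\<close> and \<open>y 1\<close>. The old color of \<open>y k\<close> occurs
    nowhere else around \<open>y 0\<close>, so it must be that of \<open>y 2\<close>.\<close>
  have ends: "c (y 2) = c (y k)" if t: "token (y 0) c" for c
  proof -
    obtain c' where c': "token (y 0) c'" "\<And>i. 1 \<le> i \<Longrightarrow> i < k \<Longrightarrow> c' (y i) = c (y (Suc i))"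
      "c' (y k) = c (y 1)" "\<And>z. z \<notin> y ` {..k} \<Longrightarrow> c' z = c z"
      using token_rotate[OF t k2 inj yB adj last] by blast
    define M where "M = N (y 0) \<inter> B - {y 1, y k}"
    have NB: "N (y 0) \<inter> B = insert (y 1) (insert (y k) M)"
      using adj[of 0] last yB k unfolding M_def by auto
    have notin: "z \<notin> y ` {..k}" if "z \<in> M" for z
      using chord that unfolding M_def by auto
    have M: "c' ` M = c ` M" using c'(4) notin by (intro image_cong) auto
    have eq: "insert (c (y 2)) (insert (c (y 1)) (c ` M)) = insert (c (y 1)) (insert (c (y k)) (c ` M))"
    proof -
      have "c' ` insert (y 1) (insert (y k) M) = c ` insert (y 1) (insert (y k) M)"
        using token_tight(2)[OF t] token_tight(2)[OF c'(1)] unfolding NB by simp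
      moreover have "c' (y 1) = c (y 2)" using c'(2)[of 1] k by (simp add: numeral_2_eq_2)
      ultimately show ?thesis by (simp only: image_insert c'(3) M)
    qed
    have inj_c: "inj_on c (insert (y 1) (insert (y k) M))"
      using token_tight(1)[OF t] NB by simp
    have "1 \<le> k" "1 \<noteq> k" using k(2) by simp_all
    then have ne: "y 1 \<noteq> y k" using y_eq by blast
    have "y k \<notin> M" unfolding M_def by blast
    then have notM: "c (y k) \<notin> c ` M"
      using inj_onD[OF inj_c, of "y k"] by blast
    have c1k: "c (y k) \<noteq> c (y 1)" using inj_onD[OF inj_c, of "y 1" "y k"] ne by auto
    have "c (y k) \<in> insert (c (y 2)) (insert (c (y 1)) (c ` M))" unfolding eq by simp
    with notM c1k show ?thesis by (metis insertE)
  qed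
  \<comment> \<open>Cyclic enumeration of the positions 1 to \<open>k\<close>; position 0 holds the
    token.\<close>
  define ix where "ix i = Suc (i mod k)" for i
  have shift: "\<exists>c'. token (y 0) c' \<and> (\<forall>i. c' (y (ix i)) = c (y (ix (i + j))))"
    if t: "token (y 0) c" for c j
  proof (induction j)
    case 0
    then show ?case using t by auto
  next
    case (Suc j)
    then obtain c1 where c1: "token (y 0) c1" "\<And>i. c1 (y (ix i)) = c (y (ix (i + j)))" by auto
    obtain c' where c': "token (y 0) c'" "\<And>i. 1 \<le> i \<Longrightarrow> i < k \<Longrightarrow> c' (y i) = c1 (y (Suc i))"
      "c' (y k) = c1 (y 1)" "\<And>z. z \<notin> y ` {..k} \<Longrightarrow> c' z = c1 z"
      using token_rotate[OF c1(1) k2 inj yB adj last] by blast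
    have "c' (y (ix i)) = c1 (y (ix (Suc i)))" for i
    proof (cases "Suc (i mod k) = k")
      case True
      then have "Suc i mod k = 0" by (simp add: mod_Suc)
      with True c' show ?thesis by (simp add: ix_def)
    next
      case False
      moreover have "i mod k < k" using k by simp
      ultimately have "Suc (i mod k) < k" "Suc i mod k = Suc (i mod k)" by (auto simp: mod_Suc)
      with c' show ?thesis by (simp add: ix_def)
    qed
    then have "c' (y (ix i)) = c (y (ix (i + Suc j)))" for i using c1(2)[of "Suc i"] by simp
    with c'(1) show ?case by blast
  qed
  obtain c where c: "token (y 0) c" using token_exists[OF y0] by blast
  \<comment> \<open>\<open>ends\<close> is applied after \<open>i + 1\<close> rotations: then
    position 2 shows the old color of position \<open>ix (i + 2)\<close> and position
    \<open>k\<close> that of \<open>ix i\<close>.\<close>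
  have per: "c (y (ix (i + 2))) = c (y (ix i))" for i
  proof -
    obtain c' where c': "token (y 0) c'" "\<And>l. c' (y (ix l)) = c (y (ix (l + (i + 1))))"
      using shift[OF c] by blast
    have "ix 1 = 2" "ix (k - 1) = k" using k by (auto simp: ix_def)
    then have "c' (y (ix 1)) = c' (y (ix (k - 1)))" using ends[OF c'(1)] by simp
    moreover have "ix (k - 1 + (i + 1)) = ix i" using k by (simp add: ix_def)
    ultimately show ?thesis using c'(2) by (simp add: numeral_2_eq_2)
  qed
  \<comment> \<open>As \<open>k\<close> is odd, steps of length 2 from position 1 reach
    \<open>k\<close> and then position 2, so the neighbors \<open>y 1\<close> and \<open>y 2\<close>
    share a color.\<close>
  have "c (y (ix (2 * j))) = c (y (ix 0))" for j
    using per by (induction j) (auto simp: numeral_2_eq_2)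
  moreover obtain l where l: "k = 2 * l + 1" using k by (auto elim: oddE)
  ultimately have "c (y (ix (2 * (l + 1)))) = c (y (ix 0))" by blast
  moreover have "ix (2 * (l + 1)) = 2"
  proof -
    have "2 * (l + 1) = k + 1" using l by simp
    then show ?thesis using k by (simp add: ix_def mod_Suc)
  qed
  ultimately have "c (y 2) = c (y 1)" by (simp add: ix_def numeral_2_eq_2)
  moreover have "y 2 \<in> N (y 1)" using adj[of 1] k by (simp add: numeral_2_eq_2)
  moreover have "y 1 \<in> B - {y 0}" "y 2 \<in> B - {y 0}" using k yB y_eq[of 1 0] y_eq[of 2 0] by auto
  ultimately show False using c unfolding token_def by (metis DiffD1 DiffI IntI DiffD2)
qed

text \<open>\<open>xs\<close> lists the cycle without its chordless vertex \<open>x\<close>, so an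
  odd length of \<open>xs\<close> means an even cycle.\<close>

lemma no_even_cycle_list:
  assumes "odd (length xs)" "length xs \<ge> 3" "distinct (x # xs)" "set (x # xs) \<subseteq> B"
    and "successively (\<lambda>a b. b \<in> N a) (x # xs)" "last xs \<in> N x"
    and "N x \<inter> set xs \<subseteq> {hd xs, last xs}"
  shows False
proof (rule no_even_cycle[of "length xs" "\<lambda>i. (x # xs) ! i"])
  let ?k = "length xs"
  have ne: "xs \<noteq> []" using assms(2) by auto
  have im: "(!) (x # xs) ` {..?k} = set (x # xs)"
    by (metis atLeast_upt image_set length_Cons lessThan_Suc_atMost map_nth)
  show "inj_on ((!) (x # xs)) {..?k}"
    using inj_on_nth[OF assms(3)] by auto
  show "(!) (x # xs) ` {..?k} \<subseteq> B" using im assms(4) by simp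
  show "(x # xs) ! Suc i \<in> N ((x # xs) ! i)" if "i < ?k" for i
    using assms(5) that unfolding successively_conv_nth by auto
  have lst: "(x # xs) ! ?k = last xs" using ne by (simp add: last_conv_nth nth_Cons')
  show "(x # xs) ! ?k \<in> N ((x # xs) ! 0)" using lst assms(6) by simp
  show "N ((x # xs) ! 0) \<inter> (!) (x # xs) ` {..?k} \<subseteq> {(x # xs) ! 1, (x # xs) ! ?k}"
    using im lst assms(7) nbr_irrefl[of x] ne by (auto simp: hd_conv_nth)
qed (use assms in auto)

end


section \<open>Exponential growth of an uncolorable ball\<close>

lemma successively_snoc2:
  "successively P (a # p @ [b]) \<Longrightarrow> P b c \<Longrightarrow> successively P (a # p @ [b, c])"
  using successively_append_iff[of P "a # p @ [b]" "[c]"] by simp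

context stuck_ball
begin

section \<open>Distance layers around the center of a stuck ball\<close>

definition sphere :: "nat \<Rightarrow> 'a set" where
  "sphere k = {x \<in> nball N k v. \<forall>j<k. x \<notin> nball N j v}"

lemma sphere_0: "sphere 0 = {v}"
  by (auto simp: sphere_def)

lemma sphere_unique: "x \<in> sphere i \<Longrightarrow> x \<in> sphere j \<Longrightarrow> i = j"
  by (auto simp: sphere_def dest: linorder_neqE_nat)

lemma sphere_neq: "x \<in> sphere i \<Longrightarrow> y \<in> sphere j \<Longrightarrow> i \<noteq> j \<Longrightarrow> x \<noteq> y"
  using sphere_unique by blast

lemma sphere_sub: "k \<le> R \<Longrightarrow> sphere k \<subseteq> B"
  using nball_mono[of k R N v] by (auto simp: sphere_def)

lemma sphere_sub_V: "sphere k \<subseteq> V"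
  using nball_closed[of V N v k] nbr_sub vV by (auto simp: sphere_def)

lemma finite_sphere: "finite (sphere k)"
  using sphere_sub_V finV by (rule finite_subset)

lemma nball_sphere: "x \<in> nball N k v \<Longrightarrow> \<exists>i\<le>k. x \<in> sphere i"
proof -
  assume x: "x \<in> nball N k v"
  define i where "i = (LEAST i. x \<in> nball N i v)"
  have "x \<in> nball N i v" "i \<le> k" "\<forall>j<i. x \<notin> nball N j v"
    unfolding i_def using x by (auto intro: LeastI Least_le dest: not_less_Least)
  then show ?thesis by (auto simp: sphere_def)
qed

lemma sphere_parent:
  assumes "x \<in> sphere (Suc k)"
  obtains p where "p \<in> N x" "p \<in> sphere k"
proof -
  have "x \<in> nball N (Suc k) v" "x \<notin> nball N k v" using assms by (auto simp: sphere_def)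
  then obtain u where u: "u \<in> nball N k v" "x \<in> N u" by (metis nball_SucE)
  then obtain i where i: "i \<le> k" "u \<in> sphere i" using nball_sphere by blast
  have "x \<in> nball N (Suc i) v" using nbr_in_nball[where N = N and u = u and w = x, OF _ u(2)] i by (simp add: sphere_def)
  then have "i = k" using i assms by (auto simp: sphere_def not_less_eq intro: ccontr)
  with i u nbr_sym that show thesis by blast
qed

lemma sphere_nbr:
  assumes "x \<in> sphere k" "y \<in> N x"
  shows "y \<in> sphere (k - 1) \<or> y \<in> sphere k \<or> y \<in> sphere (Suc k)"
proof -
  have "y \<in> nball N (Suc k) v" using nbr_in_nball[where N = N and u = x and w = y, OF _ assms(2)] assms(1) by (simp add: sphere_def)
  then obtain i where i: "i \<le> Suc k" "y \<in> sphere i" using nball_sphere by blast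
  have "x \<in> nball N (Suc i) v"
    using nbr_in_nball[where N = N and u = y and w = x, OF _ nbr_sym[OF assms(2)]] i by (simp add: sphere_def)
  then have "k \<le> Suc i" using assms by (auto simp: sphere_def not_less_eq intro: ccontr)
  then have "i = k - 1 \<or> i = k \<or> i = Suc k" using i by linarith
  with i show ?thesis by auto
qed

text \<open>As the ball is not closed, an edge leaves it, and its outer end has distance exactly
  \<open>Suc R\<close>. Passing to parents visits all smaller layers.\<close>

lemma sphere_nonempty: "k \<le> Suc R \<Longrightarrow> sphere k \<noteq> {}"
proof -
  obtain x y where x: "x \<in> B" "y \<in> N x" "y \<notin> B" using not_closed by blast
  have "y \<in> nball N (Suc R) v" using nbr_in_nball[OF x(1,2)] .
  moreover have "y \<notin> nball N j v" if "j < Suc R" for j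
    using x nball_mono[of j R N v] that by auto
  ultimately have y: "y \<in> sphere (Suc R)" by (auto simp: sphere_def)
  show "k \<le> Suc R \<Longrightarrow> sphere k \<noteq> {}"
  proof (induction k rule: inc_induct)
    case base
    then show ?case using y by blast
  next
    case (step k)
    then show ?case by (metis sphere_parent ex_in_conv)
  qed
qed

text \<open>Two vertices of the same level are joined through their lowest common ancestor.\<close>

lemma ancestor_path:
  assumes "a \<in> sphere (Suc j)" "b \<in> sphere (Suc j)" "a \<noteq> b"
    "a' \<in> N a" "a' \<in> sphere j" "b' \<in> N b" "b' \<in> sphere j"
  obtains p where "successively (\<lambda>x y. y \<in> N x) (a # p @ [b])" "odd (length p)" "distinct p"
    "hd p = a'" "last p = b'" "set p \<subseteq> (\<Union>i\<le>j. sphere i)" "set p \<inter> sphere j \<subseteq> {a', b'}"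
proof -
  have "\<exists>p. successively (\<lambda>x y. y \<in> N x) (a # p @ [b]) \<and> odd (length p) \<and> distinct p \<and>
    hd p = a' \<and> last p = b' \<and> set p \<subseteq> (\<Union>i\<le>j. sphere i) \<and> set p \<inter> sphere j \<subseteq> {a', b'}"
    using assms
  proof (induction j arbitrary: a b a' b')
    case 0
    then show ?case by (intro exI[of _ "[v]"]) (auto simp: sphere_0 nbr_sym)
  next
    case (Suc j)
    show ?case
    proof (cases "a' = b'")
      case True
      with Suc.prems show ?thesis by (intro exI[of _ "[a']"]) (auto simp: nbr_sym)
    next
      case False
      \<comment> \<open>Distinct parents are joined first; adding both of them to that path
        lengthens it by 2 and keeps its length odd.\<close>
      obtain a'' where a'': "a'' \<in> N a'" "a'' \<in> sphere j" using sphere_parent Suc.prems by metis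
      obtain b'' where b'': "b'' \<in> N b'" "b'' \<in> sphere j" using sphere_parent Suc.prems by metis
      obtain p where p: "successively (\<lambda>x y. y \<in> N x) (a' # p @ [b'])" "odd (length p)"
        "distinct p" "set p \<subseteq> (\<Union>i\<le>j. sphere i)"
        using Suc.IH[of a' b' a'' b''] Suc.prems False a'' b'' by blast
      have new: "x \<notin> set p" if "x \<in> sphere (Suc j)" for x
        using p(4) that sphere_unique by fastforce
      show ?thesis
      proof (intro exI[of _ "a' # p @ [b']"] conjI)
        show "successively (\<lambda>x y. y \<in> N x) (a # (a' # p @ [b']) @ [b])"
          using successively_snoc2[OF p(1), of b] Suc.prems nbr_sym by simp
        show "distinct (a' # p @ [b'])" using p(3) new Suc.prems False by auto
        show "set (a' # p @ [b']) \<subseteq> (\<Union>i\<le>Suc j. sphere i)"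
          using p(4) Suc.prems by (auto simp: atMost_Suc)
        show "set (a' # p @ [b']) \<inter> sphere (Suc j) \<subseteq> {a', b'}" using new by auto
      qed (use p in auto)
    qed
  qed
  with that show thesis by blast
qed

lemma below_sub: "j \<le> R \<Longrightarrow> (\<Union>i\<le>j. sphere i) \<subseteq> B"
  using sphere_sub by (meson UN_least atMost_iff le_trans)

lemma not_below: "x \<in> sphere k \<Longrightarrow> j < k \<Longrightarrow> x \<notin> (\<Union>i\<le>j. sphere i)"
  using sphere_unique by fastforce

text \<open>Two parents, joined through lower layers, would close an even cycle with
  \<open>u\<close>. There is no chord at \<open>u\<close>, since the inner vertices of the joining
  path are at least two layers closer to the root.\<close>

lemma parent_unique:
  assumes u: "u \<in> sphere (Suc j)" "Suc j \<le> R"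
    and p: "p \<in> N u" "p \<in> sphere j" "p' \<in> N u" "p' \<in> sphere j"
  shows "p = p'"
proof (rule ccontr)
  assume ne: "p \<noteq> p'"
  then obtain i where j: "j = Suc i" using p sphere_0 by (cases j) auto
  obtain q q' where q: "q \<in> N p" "q \<in> sphere i" "q' \<in> N p'" "q' \<in> sphere i"
    using sphere_parent p j by metis
  obtain w where w: "successively (\<lambda>x y. y \<in> N x) (p # w @ [p'])" "odd (length w)" "distinct w"
    "set w \<subseteq> (\<Union>l\<le>i. sphere l)"
    using ancestor_path[of p i p' q q'] p q j ne by metis
  have new: "x \<notin> set w" if "x \<in> sphere l" "l > i" for x l
    using w(4) not_below[OF that] by blast
  have far: "N u \<inter> set w = {}"
  proof -
    have "x \<notin> set w" if "x \<in> N u" for x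
      using sphere_nbr[OF u(1) that] new[of x] j by force
    then show ?thesis by blast
  qed
  have sub: "set w \<subseteq> B" using w(4) below_sub[of i] u j by auto
  show False
  proof (rule no_even_cycle_list[of "p # w @ [p']" u])
    show "distinct (u # p # w @ [p'])"
      using w(3) ne new[OF u(1)] new[OF p(2)] new[OF p(4)] j p nbr_irrefl by auto
    show "set (u # p # w @ [p']) \<subseteq> B"
      using sub sphere_sub[of j] sphere_sub[of "Suc j"] u p by auto
    show "successively (\<lambda>a b. b \<in> N a) (u # p # w @ [p'])" using w(1) p by simp
    show "N u \<inter> set (p # w @ [p']) \<subseteq> {hd (p # w @ [p']), last (p # w @ [p'])}"
      using far by auto
    show "3 \<le> length (p # w @ [p'])" using w(2) by (cases w) auto
  qed (use w p in auto)
qed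

text \<open>The edges inside the two layers yield an even cycle: \<open>x\<close>, \<open>u\<close>,
  \<open>u'\<close>, then through lower layers to \<open>z\<close>, then \<open>y\<close>; it is a
  4-cycle if \<open>u' = z\<close>. There is no chord at \<open>x\<close>, whose only parent is
  \<open>u\<close>.\<close>

lemma sibling_conflict:
  assumes u: "u \<in> sphere i" "Suc i \<le> R"
    and x: "x \<in> sphere (Suc i)" "u \<in> N x"
    and y: "y \<in> sphere (Suc i)" "y \<in> N x" "z \<in> N y" "z \<in> sphere i" "z \<noteq> u"
    and u': "u' \<in> sphere i" "u' \<in> N u"
  shows False
proof -
  have px: "a = u" if "a \<in> N x" "a \<in> sphere i" for a
    using parent_unique[OF x(1) u(2) that x(2) u(1)] .
  have ne: "u \<noteq> u'" "x \<noteq> y" using u'(2) y(2) nbr_irrefl by auto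
  have lv: "a \<noteq> b" if "a \<in> sphere i" "b \<in> sphere (Suc i)" for a b
    using sphere_neq[OF that] by simp
  have inB: "u \<in> B" "x \<in> B" "y \<in> B" "z \<in> B" "u' \<in> B"
    using sphere_sub[of i] sphere_sub[of "Suc i"] u x y u' by auto
  show False
  proof (cases "u' = z")
    case True
    show False
    proof (rule no_even_cycle_list[of "[u, u', y]" x])
      show "distinct (x # [u, u', y])" using ne lv u x y u' by fastforce
      show "N x \<inter> set [u, u', y] \<subseteq> {hd [u, u', y], last [u, u', y]}"
        using px u' ne by auto
    qed (use inB x y u' True nbr_sym in auto)
  next
    case False
    obtain k where i: "i = Suc k" using u u' ne sphere_0 by (cases i) auto
    obtain q q' where q: "q \<in> N u'" "q \<in> sphere k" "q' \<in> N z" "q' \<in> sphere k"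
      using sphere_parent u' y i by metis
    obtain w where w: "successively (\<lambda>x y. y \<in> N x) (u' # w @ [z])" "odd (length w)" "distinct w"
      "set w \<subseteq> (\<Union>l\<le>k. sphere l)"
      using ancestor_path[of u' k z q q'] u' y q i False by metis
    have new: "a \<notin> set w" if "a \<in> sphere l" "l > k" for a l
      using w(4) not_below[OF that] by blast
    have sub: "set w \<subseteq> B" using w(4) below_sub[of k] u i by auto
    have far: "a \<notin> set w" if "a \<in> N x" for a
      using sphere_nbr[OF x(1) that] new[of a] i by force
    let ?c = "u # u' # w @ [z, y]"
    show False
    proof (rule no_even_cycle_list[of ?c x])
      have "u \<notin> set w" "u' \<notin> set w" "z \<notin> set w" "x \<notin> set w" "y \<notin> set w"
        using new u u' x y i by auto
      then show "distinct (x # ?c)" using ne lv u x y u' False w(3) by fastforce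
      show "N x \<inter> set ?c \<subseteq> {hd ?c, last ?c}" using px u' y far ne by auto
      show "successively (\<lambda>a b. b \<in> N a) (x # ?c)"
        using successively_snoc2[OF w(1), of y] x u' y nbr_sym by simp
      show "set (x # ?c) \<subseteq> B" using sub inB by auto
      show "odd (length ?c)" using w(2) by simp
      show "last ?c \<in> N x" using y by simp
    qed simp
  qed
qed

abbreviation children where "children u k \<equiv> N u \<inter> sphere (Suc k)"

text \<open>Without children, \<open>u\<close> has only its parent \<open>p\<close> and a set
  \<open>S\<close> of \<open>d - 1\<close> neighbors in its own layer. Excluding even cycles makes
  \<open>p\<close>, \<open>u\<close> and \<open>S\<close> a clique on \<open>d + 1\<close> vertices,
  hence a whole component, although there are vertices at distance 2.\<close>

lemma has_child:
  assumes u: "u \<in> sphere (Suc i)" "Suc i < R"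
  shows "children u (Suc i) \<noteq> {}"
proof
  assume none: "children u (Suc i) = {}"
  have le: "Suc i \<le> R" "i \<le> R" using u by auto
  obtain p where p: "p \<in> N u" "p \<in> sphere i" using sphere_parent[OF u(1)] by blast
  define S where "S = N u \<inter> sphere (Suc i)"
  have uB: "u \<in> B" using sphere_sub[OF le(1)] u by auto
  have pu: "a = p" if "a \<in> N u" "a \<in> sphere i" for a
    using parent_unique[OF u(1) le(1) that p] .
  have Nu: "N u = insert p S"
  proof (intro equalityI subsetI)
    fix a assume a: "a \<in> N u"
    then have "a \<in> sphere i \<or> a \<in> sphere (Suc i)" using sphere_nbr[OF u(1) a] none by auto
    then show "a \<in> insert p S" using a pu by (auto simp: S_def)
  qed (use p S_def in auto)
  have pS: "p \<notin> S" using sphere_unique[OF p(2), of "Suc i"] by (auto simp: S_def)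
  have finS: "finite S" unfolding S_def by simp
  have cardS: "Suc (card S) = d" using full_degree[OF uB] Nu pS finS by simp
  have pi: "p \<in> B" using sphere_sub[OF le(2)] p by auto
  have lv: "a \<noteq> b" if "a \<in> sphere i" "b \<in> sphere (Suc i)" for a b
    using sphere_neq[OF that] by simp
  \<comment> \<open>If \<open>s\<close> has another parent \<open>p'\<close>, then \<open>p\<close>
    has no neighbor in its own layer and some \<open>t\<close> in \<open>S\<close> is a child of
    \<open>p\<close>. The cycle \<open>p'\<close>, \<open>s\<close>, \<open>u\<close>,
    \<open>t\<close>, \<open>p\<close> and back through lower layers is even and has no chord at
    \<open>p'\<close>.\<close>
  have all_p: "s \<in> N p" if s: "s \<in> S" for s
  proof (rule ccontr)
    assume sp: "s \<notin> N p"
    have sS: "s \<in> N u" "s \<in> sphere (Suc i)" using s by (auto simp: S_def)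
    obtain p' where p': "p' \<in> N s" "p' \<in> sphere i" using sphere_parent[OF sS(2)] by blast
    have ne: "p \<noteq> p'" using p' sp nbr_sym by blast
    obtain k where i: "i = Suc k" using p p' ne sphere_0 by (cases i) auto
    have p_iso: "a \<notin> sphere i" if "a \<in> N p" for a
      using sibling_conflict[of p i u s p' a] u p sS p' ne that by auto
    have "S \<noteq> {s}" using cardS d3 by auto
    then obtain t where t: "t \<in> S" "t \<noteq> s" using s by auto
    have tS: "t \<in> N u" "t \<in> sphere (Suc i)" using t by (auto simp: S_def)
    have uniq: "a = p'" if "a \<in> N s" "a \<in> sphere i" for a
      using parent_unique[OF sS(2) le(1) that p'] .
    have inB: "s \<in> B" "t \<in> B" "p' \<in> B"
      using sphere_sub[OF le(1)] sphere_sub[OF le(2)] sS tS p' by auto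
    \<comment> \<open>If neither \<open>s\<close> nor \<open>t\<close> is a child of
      \<open>p\<close>, their joining path avoids \<open>p\<close> and closes to an even cycle
      without a chord at \<open>u\<close>.\<close>
    have tp: "t \<in> N p"
    proof (rule ccontr)
      assume tp: "t \<notin> N p"
      obtain q where q: "q \<in> N t" "q \<in> sphere i" using sphere_parent[OF tS(2)] by blast
      obtain w where w: "successively (\<lambda>x y. y \<in> N x) (s # w @ [t])" "odd (length w)" "distinct w"
        "set w \<subseteq> (\<Union>l\<le>i. sphere l)" "set w \<inter> sphere i \<subseteq> {p', q}"
        using ancestor_path[of s i t p' q] sS tS p' q t by metis
      have new: "a \<notin> set w" if "a \<in> sphere l" "l > i" for a l
        using w(4) not_below[OF that] by blast
      have far: "a \<notin> set w" if "a \<in> N u" for a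
      proof
        assume a: "a \<in> set w"
        have "a = p" using that a Nu new[of a "Suc i"] unfolding S_def by auto
        then have "p \<in> {p', q}" using a w(5) p by auto
        then show False using ne tp q nbr_sym by auto
      qed
      let ?c = "s # w @ [t]"
      show False
      proof (rule no_even_cycle_list[of ?c u])
        show "distinct (u # ?c)"
          using new[OF u(1)] new[OF sS(2)] new[OF tS(2)] w(3) t(2) sS(1) tS(1) nbr_irrefl by auto
        show "set (u # ?c) \<subseteq> B" using inB uB w(4) below_sub[OF le(2)] by auto
        show "N u \<inter> set ?c \<subseteq> {hd ?c, last ?c}" using far by auto
        show "successively (\<lambda>a b. b \<in> N a) (u # ?c)" using w(1) sS by simp
        show "3 \<le> length ?c" using w(2) by (cases w) auto
      qed (use w(2) tS in auto)
    qed
    have uniqt: "a = p" if "a \<in> N t" "a \<in> sphere i" for a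
      using parent_unique[OF tS(2) le(1) that] p tp nbr_sym by blast
    obtain q where q: "q \<in> N p" "q \<in> sphere k" using sphere_parent p i by metis
    obtain q' where q': "q' \<in> N p'" "q' \<in> sphere k" using sphere_parent p' i by metis
    obtain w where w: "successively (\<lambda>x y. y \<in> N x) (p # w @ [p'])" "odd (length w)" "distinct w"
      "last w = q'" "set w \<subseteq> (\<Union>l\<le>k. sphere l)" "set w \<inter> sphere k \<subseteq> {q, q'}"
      using ancestor_path[of p k p' q q'] p p' q q' i ne by metis
    have wne: "w \<noteq> []" using w(2) by auto
    have new: "a \<notin> set w" if "a \<in> sphere l" "l > k" for a l
      using w(5) not_below[OF that] by blast
    have far: "a = q'" if "a \<in> N p'" "a \<in> set w" for a
    proof -
      have p'k: "p' \<in> sphere (Suc k)" using p' i by simp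
      have "a \<in> sphere k" using sphere_nbr[OF p'k that(1)] new[of a] that(2) by force
      then show ?thesis using parent_unique[OF p'k _ that(1)] q' le i by auto
    qed
    let ?c = "s # u # t # p # w"
    show False
    proof (rule no_even_cycle_list[of ?c p'])
      have "u \<noteq> s" "u \<noteq> t" using sS tS nbr_irrefl by auto
      moreover have "p' \<notin> set w" "p \<notin> set w" "s \<notin> set w" "t \<notin> set w" "u \<notin> set w"
        using new p p' sS tS u i by auto
      ultimately show "distinct (p' # ?c)"
        using ne t(2) lv p p' sS tS u w(3) by fastforce
      show "set (p' # ?c) \<subseteq> B" using inB uB pi w(5) below_sub[of k] le i by auto
      have "u \<notin> N p'" using pu p' ne nbr_sym by blast
      moreover have "t \<notin> N p'" using uniqt p' ne nbr_sym by blast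
      moreover have "p \<notin> N p'" using p_iso p' nbr_sym by blast
      ultimately show "N p' \<inter> set ?c \<subseteq> {hd ?c, last ?c}" using far w(4) wne by auto
      show "successively (\<lambda>a b. b \<in> N a) (p' # ?c)"
        using successively_append_iff[of _ "p # w" "[p']"] w(1) p' sS tS tp nbr_sym by simp
      show "last ?c \<in> N p'" using w(4) wne q' by simp
    qed (use w(2) in auto)
  qed
  \<comment> \<open>Otherwise \<open>s\<close>, \<open>p\<close>, \<open>t\<close>, \<open>u\<close>
    is a 4-cycle without a chord at \<open>s\<close>.\<close>
  have clique: "t \<in> N s" if st: "s \<in> S" "t \<in> S" "s \<noteq> t" for s t
  proof (rule ccontr)
    assume no: "t \<notin> N s"
    have S': "s \<in> N u" "s \<in> sphere (Suc i)" "t \<in> N u" "t \<in> sphere (Suc i)"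
      using st by (auto simp: S_def)
    show False
    proof (rule no_even_cycle_list[of "[p, t, u]" s])
      show "distinct (s # [p, t, u])" using st pS S' p nbr_irrefl by auto
      show "set (s # [p, t, u]) \<subseteq> B" using S' uB pi sphere_sub[OF le(1)] by auto
      show "successively (\<lambda>a b. b \<in> N a) (s # [p, t, u])"
        using all_p st S' nbr_sym by auto
      show "N s \<inter> set [p, t, u] \<subseteq> {hd [p, t, u], last [p, t, u]}" using no by auto
    qed (use S' nbr_sym in auto)
  qed
  have uS: "u \<notin> S" using nbr_irrefl by (auto simp: S_def)
  have Np: "N p = insert u S"
  proof (rule card_subset_eq[symmetric])
    show "insert u S \<subseteq> N p" using all_p p nbr_sym by auto
    show "card (insert u S) = card (N p)" using uS finS cardS full_degree[OF pi] by simp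
  qed simp
  \<comment> \<open>The \<open>d\<close> neighbors of \<open>p\<close> are exhausted by
    \<open>u\<close> and \<open>S\<close>, which leaves no parent for \<open>p\<close>.\<close>
  have "i = 0"
  proof (cases i)
    case (Suc k)
    then obtain q where q: "q \<in> N p" "q \<in> sphere k" using sphere_parent p by metis
    then have "q \<in> sphere (Suc i)" using Np u unfolding S_def by auto
    with sphere_unique[OF q(2)] Suc show ?thesis by auto
  qed
  then have "p = v" using p sphere_0 by simp
  have Ns: "N s \<subseteq> insert u (insert p S)" if s: "s \<in> S" for s
  proof -
    have "insert u (insert p (S - {s})) = N s"
    proof (rule card_subset_eq)
      show "insert u (insert p (S - {s})) \<subseteq> N s"
        using nbr_sym[of s u] nbr_sym[OF all_p[OF s]] clique[OF s] s by (auto simp: S_def)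
      have "card (S - {s}) = card S - 1" using s by simp
      moreover have "u \<notin> S - {s}" "p \<notin> S - {s}" "u \<noteq> p" using uS pS p nbr_irrefl by auto
      ultimately have "card (insert u (insert p (S - {s}))) = Suc (Suc (card S - 1))"
        using finS by simp
      also have "\<dots> = d" using cardS d3 by simp
      also have "\<dots> = card (N s)"
        using full_degree[of s] sphere_sub[OF le(1)] s by (auto simp: S_def)
      finally show "card (insert u (insert p (S - {s}))) = card (N s)" .
    qed simp
    then show ?thesis by auto
  qed
  obtain z where z: "z \<in> sphere 2" using sphere_nonempty[of 2] R2 by auto
  then obtain y where y: "y \<in> N z" "y \<in> sphere (Suc 0)"
    using sphere_parent[of z 1] by (auto simp: numeral_2_eq_2)
  obtain x where "x \<in> N y" "x \<in> sphere 0" using sphere_parent[OF y(2)] by blast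
  then have "y \<in> insert u S" using Np \<open>p = v\<close> sphere_0 nbr_sym by auto
  then have "z \<in> insert u (insert p S)" using Ns Nu nbr_sym[OF y(1)] by blast
  then have "z \<in> sphere 1 \<or> z \<in> sphere 0" using u p \<open>i = 0\<close> unfolding S_def by auto
  then show False using sphere_unique[OF z] by fastforce
qed

text \<open>If \<open>x\<close> had a neighbor in its layer, \<open>sibling_conflict\<close> would
  leave \<open>u\<close> with its parent and \<open>x\<close> only, too few for degree
  \<open>d\<close>. Hence all neighbors of \<open>x\<close> except \<open>u\<close> are children, at
  least \<open>d - 1\<close> of them.\<close>

lemma only_child:
  assumes u: "u \<in> sphere (Suc i)" "Suc (Suc i) < R" and one: "children u (Suc i) = {x}"
  shows "2 \<le> card (children x (Suc (Suc i)))"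
proof -
  have le: "Suc (Suc i) \<le> R" "Suc i \<le> R" using u by auto
  have x: "x \<in> N u" "x \<in> sphere (Suc (Suc i))" using one by auto
  have sib: "N x \<inter> sphere (Suc (Suc i)) = {}"
  proof (rule ccontr)
    assume "N x \<inter> sphere (Suc (Suc i)) \<noteq> {}"
    then obtain y where y: "y \<in> N x" "y \<in> sphere (Suc (Suc i))" by auto
    obtain z where z: "z \<in> N y" "z \<in> sphere (Suc i)" using sphere_parent[OF y(2)] by blast
    have "z \<noteq> u"
    proof
      assume "z = u"
      then have "y \<in> children u (Suc i)" using z y nbr_sym by auto
      then show False using one y nbr_irrefl by auto
    qed
    then have "u' \<notin> sphere (Suc i)" if "u' \<in> N u" for u'
      using sibling_conflict[of u "Suc i" x y z u'] u x y z nbr_sym that le by auto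
    moreover obtain p where p: "p \<in> N u" "p \<in> sphere i" using sphere_parent[OF u(1)] by blast
    moreover have "a = p" if "a \<in> N u" "a \<in> sphere i" for a
      using parent_unique[OF u(1) le(2) that p] .
    moreover have "a = x" if "a \<in> N u" "a \<in> sphere (Suc (Suc i))" for a
      using one that by blast
    ultimately have "a \<in> {p, x}" if "a \<in> N u" for a
      using sphere_nbr[OF u(1) that] that by (metis diff_Suc_1 insertCI)
    then have "N u \<subseteq> {p, x}" by blast
    then have "card (N u) \<le> 2" using card_mono[of "{p, x}" "N u"] by (simp add: card_insert_if split: if_splits)
    then show False using full_degree[of u] u d3 sphere_sub[OF le(2)] by auto
  qed
  have "a = u" if "a \<in> N x" "a \<in> sphere (Suc i)" for a
    using parent_unique[OF x(2) le(1) that nbr_sym[OF x(1)] u(1)] .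
  then have "N x \<subseteq> insert u (children x (Suc (Suc i)))"
    using sphere_nbr[OF x(2)] sib by auto
  then have "card (N x) \<le> card (insert u (children x (Suc (Suc i))))"
    by (intro card_mono) auto
  also have "\<dots> \<le> Suc (card (children x (Suc (Suc i))))"
    by (simp add: card_insert_if)
  finally have "card (N x) \<le> Suc (card (children x (Suc (Suc i))))" .
  then show ?thesis using full_degree[of x] x d3 sphere_sub[OF le(1)] by auto
qed

section \<open>Counting the layers\<close>

lemma card_sphere_Suc:
  assumes "Suc i \<le> R"
  shows "card (sphere (Suc i)) = (\<Sum>u\<in>sphere i. card (children u i))"
proof -
  have eq: "sphere (Suc i) = (\<Union>u\<in>sphere i. children u i)"
    by (auto elim: sphere_parent intro: nbr_sym)
  have "children u i \<inter> children u' i = {}"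
    if "u \<in> sphere i" "u' \<in> sphere i" "u \<noteq> u'" for u u'
  proof -
    have "u = u'" if "a \<in> children u i" "a \<in> children u' i" for a
    proof (rule parent_unique[of a "i"])
      show "u \<in> N a" "u' \<in> N a" using that nbr_sym by auto
    qed (use that assms \<open>u \<in> sphere i\<close> \<open>u' \<in> sphere i\<close> in auto)
    with that show ?thesis by blast
  qed
  then have "card (\<Union>u\<in>sphere i. children u i) = (\<Sum>u\<in>sphere i. card (children u i))"
    by (intro card_UN_disjoint) (auto simp: finite_sphere)
  with eq show ?thesis by metis
qed

lemma card_children_pos: "u \<in> sphere (Suc i) \<Longrightarrow> Suc i < R \<Longrightarrow> 1 \<le> card (children u (Suc i))"
  using has_child[of u i] by (simp add: Suc_le_eq card_gt_0_iff)

lemma grandchildren: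
  assumes u: "u \<in> sphere (Suc i)" "Suc (Suc i) < R"
  shows "2 \<le> (\<Sum>x\<in>children u (Suc i). card (children x (Suc (Suc i))))"
proof (cases "card (children u (Suc i)) = 1")
  case True
  then obtain x where x: "children u (Suc i) = {x}" using card_1_singletonE by blast
  show ?thesis using only_child[OF u x] unfolding x by simp
next
  case False
  then have "2 \<le> card (children u (Suc i))" using card_children_pos[OF u(1)] u by linarith
  also have "\<dots> \<le> (\<Sum>x\<in>children u (Suc i). card (children x (Suc (Suc i))))"
    using sum_mono[of "children u (Suc i)" "\<lambda>_. 1" "\<lambda>x. card (children x (Suc (Suc i)))"]
      card_children_pos[of _ "Suc i"] u by simp
  finally show ?thesis .
qed

lemma sphere_doubling:
  assumes "Suc (Suc i) < R"
  shows "2 * card (sphere (Suc i)) \<le> card (sphere (Suc (Suc (Suc i))))"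
proof -
  let ?g = "\<lambda>x. card (children x (Suc (Suc i)))"
  have eq: "sphere (Suc (Suc i)) = (\<Union>u\<in>sphere (Suc i). children u (Suc i))"
    by (auto elim: sphere_parent intro: nbr_sym)
  have disj: "children u (Suc i) \<inter> children u' (Suc i) = {}"
    if "u \<in> sphere (Suc i)" "u' \<in> sphere (Suc i)" "u \<noteq> u'" for u u'
  proof -
    have "u = u'" if "a \<in> children u (Suc i)" "a \<in> children u' (Suc i)" for a
    proof (rule parent_unique[of a "Suc i"])
      show "u \<in> N a" "u' \<in> N a" using that nbr_sym by auto
    qed (use that assms \<open>u \<in> sphere (Suc i)\<close> \<open>u' \<in> sphere (Suc i)\<close> in auto)
    with that show ?thesis by blast
  qed
  have "2 * card (sphere (Suc i)) = (\<Sum>u\<in>sphere (Suc i). 2)" by simp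
  also have "\<dots> \<le> (\<Sum>u\<in>sphere (Suc i). \<Sum>x\<in>children u (Suc i). ?g x)"
    using grandchildren assms by (intro sum_mono) auto
  also have "\<dots> = (\<Sum>x\<in>sphere (Suc (Suc i)). ?g x)"
    using sum.UNION_disjoint[of "sphere (Suc i)" "\<lambda>u. children u (Suc i)" ?g, folded eq] finite_sphere disj
    by simp
  also have "\<dots> = card (sphere (Suc (Suc (Suc i))))"
    using card_sphere_Suc[of "Suc (Suc i)"] assms by simp
  finally show ?thesis .
qed

text \<open>The doubling starts in layer 1, because \<open>has_child\<close> does not cover the
  root, and proceeds along the odd layers.\<close>

lemma exponential_growth: "2 * m + 1 \<le> R \<Longrightarrow> 2 ^ m \<le> card V"
proof -
  have "2 * m + 1 \<le> R \<Longrightarrow> 2 ^ m \<le> card (sphere (2 * m + 1))"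
  proof (induction m)
    case 0
    have "sphere 1 \<noteq> {}" using sphere_nonempty R2 by simp
    then show ?case using finite_sphere[of 1] by (simp add: Suc_le_eq card_gt_0_iff)
  next
    case (Suc m)
    then show ?case using sphere_doubling[of "2 * m"] by simp
  qed
  moreover have "card (sphere (2 * m + 1)) \<le> card V" by (intro card_mono[OF finV] sphere_sub_V)
  ultimately show "2 * m + 1 \<le> R \<Longrightarrow> 2 ^ m \<le> card V" by (metis le_trans)
qed

end


section \<open>Local maps\<close>

text \<open>A distributed procedure with \<open>r\<close> rounds, seen as a map from labellings to labellings.\<close>

definition local_map :: "nat \<Rightarrow> (('a \<Rightarrow> 'a set) \<Rightarrow> ('a \<Rightarrow> 'i) \<Rightarrow> 'a \<Rightarrow> 'o) \<Rightarrow> bool" where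
  "local_map r F \<longleftrightarrow> (\<forall>N N' p p' v.
     (\<forall>u\<in>nball N r v. N u = N' u \<and> p u = p' u) \<longrightarrow> F N p v = F N' p' v)"

lemma local_mapI:
  assumes "\<And>N N' p p' v. (\<And>u. u \<in> nball N r v \<Longrightarrow> N u = N' u \<and> p u = p' u) \<Longrightarrow> F N p v = F N' p' v"
  shows "local_map r F"
  using assms unfolding local_map_def by blast

lemma local_mapD:
  assumes "local_map r F" "\<And>u. u \<in> nball N r v \<Longrightarrow> N u = N' u \<and> p u = p' u"
  shows "F N p v = F N' p' v"
  using assms unfolding local_map_def by blast

lemma nball_cong:
  assumes "\<And>u. u \<in> nball N r v \<Longrightarrow> N u = N' u"
  shows "nball N r v = nball N' r v"
  using assms
proof (induction r arbitrary: v)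
  case (Suc r)
  have "N v = N' v" using Suc.prems by simp
  moreover have "nball N r u = nball N' r u" if "u \<in> N v" for u
    using Suc.prems that by (intro Suc.IH) (auto simp: nball.simps(2))
  ultimately show ?case by (simp add: nball.simps(2))
qed simp

lemma local_map_mono: "local_map a F \<Longrightarrow> a \<le> b \<Longrightarrow> local_map b F"
  using nball_mono[of a b] unfolding local_map_def by (meson subsetD)

lemma local_map_comp:
  fixes F :: "('a \<Rightarrow> 'a set) \<Rightarrow> ('a \<Rightarrow> 'b) \<Rightarrow> 'a \<Rightarrow> 'c"
  assumes F: "local_map a F" and H: "local_map b H"
  shows "local_map (a + b) (\<lambda>N p. H N (F N p))"
proof (rule local_mapI)
  fix N N' :: "'a \<Rightarrow> 'a set" and p p' :: "'a \<Rightarrow> 'b" and v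
  assume agree: "\<And>u. u \<in> nball N (a + b) v \<Longrightarrow> N u = N' u \<and> p u = p' u"
  have sub: "w \<in> nball N (a + b) v" if "u \<in> nball N b v" "w \<in> nball N a u" for u w
    using nball_add[OF that] by (simp add: add.commute)
  have "N u = N' u \<and> F N p u = F N' p' u" if "u \<in> nball N b v" for u
    using agree sub[OF that] local_mapD[OF F, of N u N' p p'] center_in_nball by metis
  then show "H N (F N p) v = H N' (F N' p') v"
    by (rule local_mapD[OF H])
qed

lemma local_map_Pair:
  "local_map a F \<Longrightarrow> local_map a H \<Longrightarrow> local_map a (\<lambda>N p v. (F N p v, H N p v))"
  unfolding local_map_def by blast

lemma local_map_input: "local_map r (\<lambda>N p. p)"
  by (rule local_mapI) simp

section \<open>Scheduled greedy coloring\<close>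

text \<open>\<open>q\<close> gives each vertex the step at which it chooses and its list. A vertex
  scheduled at step \<open>t\<close> or later is uncolored after \<open>t\<close> steps. If no color
  is free, \<open>SOME\<close> yields an arbitrary value; \<open>greedy_choice\<close> rules this
  out.\<close>

primrec greedy :: "('a \<Rightarrow> 'a set) \<Rightarrow> ('a \<Rightarrow> nat \<times> 'c set) \<Rightarrow> nat \<Rightarrow> 'a \<Rightarrow> 'c option" where
  "greedy N q 0 u = None"
| "greedy N q (Suc t) u =
    (if fst (q u) = t then Some (SOME x. x \<in> snd (q u) \<and> (\<forall>w\<in>N u. greedy N q t w \<noteq> Some x))
     else greedy N q t u)"

lemma local_greedy: "local_map t (\<lambda>N q. greedy N q t)"
proof (rule local_mapI)
  fix N N' :: "'a \<Rightarrow> 'a set" and q q' :: "'a \<Rightarrow> nat \<times> 'b set" and v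
  assume "\<And>u. u \<in> nball N t v \<Longrightarrow> N u = N' u \<and> q u = q' u"
  then show "greedy N q t v = greedy N' q' t v"
  proof (induction t arbitrary: v)
    case (Suc t)
    have "N v = N' v" "q v = q' v" using Suc.prems[of v] by simp_all
    moreover have "greedy N q t w = greedy N' q' t w" if "w \<in> N v" for w
      using Suc.prems that by (intro Suc.IH) (auto simp: nball.simps(2))
    moreover have "greedy N q t v = greedy N' q' t v"
      using Suc.prems nball_mono[of t "Suc t" N v] by (intro Suc.IH) auto
    ultimately show ?case by simp
  qed simp
qed

lemma greedy_None_iff: "greedy N q t u = None \<longleftrightarrow> t \<le> fst (q u)"
  by (induction t) auto

lemma greedy_final: "fst (q u) < t \<Longrightarrow> greedy N q t u = greedy N q (Suc (fst (q u))) u"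
proof (induction t)
  case (Suc t)
  then show ?case by (cases "fst (q u) = t") auto
qed simp

text \<open>Only neighbors scheduled earlier are colored when \<open>u\<close> chooses; if there are
  fewer of them than colors, one is free, and an infinite list always has a free color.\<close>

lemma greedy_choice:
  assumes "finite (N u)" and \<tau>: "fst (q u) < t"
    and "finite (snd (q u)) \<Longrightarrow> card {w \<in> N u. fst (q w) < fst (q u)} < card (snd (q u))"
  shows "\<exists>x\<in>snd (q u). greedy N q t u = Some x \<and>
    (\<forall>w\<in>N u. fst (q w) < fst (q u) \<longrightarrow> greedy N q t w \<noteq> Some x)"
proof -
  define s where "s = fst (q u)"
  define A where "A = {w \<in> N u. fst (q w) < s}"
  define F where "F = (\<lambda>w. the (greedy N q s w)) ` A"
  have fin: "finite A" "finite F" using assms(1) by (auto simp: A_def F_def)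
  have "\<not> snd (q u) \<subseteq> F"
  proof
    assume sub: "snd (q u) \<subseteq> F"
    then have "card (snd (q u)) \<le> card F" using fin by (intro card_mono)
    also have "\<dots> \<le> card A" unfolding F_def using fin by (intro card_image_le)
    finally show False using assms(3) finite_subset[OF sub fin(2)] by (simp add: A_def s_def)
  qed
  then obtain x0 where x0: "x0 \<in> snd (q u)" "x0 \<notin> F" by blast
  have free: "greedy N q s w \<noteq> Some x0" if w: "w \<in> N u" for w
  proof (cases "fst (q w) < s")
    case True
    with w x0(2) show ?thesis by (force simp: F_def A_def)
  next
    case False
    then have "greedy N q s w = None" by (simp add: greedy_None_iff)
    then show ?thesis by simp
  qed
  define x where "x = (SOME x. x \<in> snd (q u) \<and> (\<forall>w\<in>N u. greedy N q s w \<noteq> Some x))"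
  have x: "x \<in> snd (q u) \<and> (\<forall>w\<in>N u. greedy N q s w \<noteq> Some x)"
    unfolding x_def by (rule someI[of _ x0]) (use x0 free in blast)
  show ?thesis
  proof (intro bexI[of _ x] conjI ballI impI)
    show "greedy N q t u = Some x" using greedy_final[where q = q and N = N, OF \<tau>] by (simp add: x_def s_def)
    show "x \<in> snd (q u)" using x by blast
    fix w assume w: "w \<in> N u" "fst (q w) < fst (q u)"
    have "greedy N q t w = greedy N q s w"
      using greedy_final[of q w t N] greedy_final[of q w s N] w \<tau> by (simp add: s_def)
    then show "greedy N q t w \<noteq> Some x" using x w by simp
  qed
qed

lemma (in nbr_graph) greedy_proper:
  assumes avail: "\<And>u. u \<in> V \<Longrightarrow> fst (q u) < t \<Longrightarrow> finite (snd (q u)) \<Longrightarrow>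
      card {w \<in> N u. fst (q w) < fst (q u)} < card (snd (q u))"
    and distinct: "\<And>u w. w \<in> N u \<Longrightarrow> fst (q u) < t \<Longrightarrow> fst (q u) \<noteq> fst (q w)"
    and uw: "w \<in> N u" "greedy N q t u = Some x"
  shows "greedy N q t w \<noteq> Some x"
proof
  assume w: "greedy N q t w = Some x"
  have lt: "fst (q u) < t" "fst (q w) < t"
    using uw w greedy_None_iff[of N q t] by (metis not_le option.distinct(1))+
  have V: "u \<in> V" "w \<in> V" using uw nbr_sub nbr_sym by blast+
  show False
  proof (cases "fst (q w) < fst (q u)")
    case True
    then show False
      using greedy_choice[where N = N and q = q, OF finN lt(1) avail[OF V(1) lt(1)]] uw w by auto
  next
    case False
    then have "fst (q u) < fst (q w)" using distinct[OF uw(1) lt(1)] by linarith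
    then show False
      using greedy_choice[where N = N and q = q, OF finN lt(2) avail[OF V(2) lt(2)]] uw w nbr_sym
      by auto
  qed
qed

section \<open>Symmetry breaking by merging blocks of identifiers\<close>

text \<open>Blocks are the aligned intervals of \<open>2 ^ k\<close> identifiers: single vertices
  for \<open>k = 0\<close>, and everything once \<open>2 ^ k\<close> exceeds all
  identifiers.\<close>

definition block_nbrs :: "nat \<Rightarrow> (nat \<Rightarrow> nat set) \<Rightarrow> nat \<Rightarrow> nat set" where
  "block_nbrs k N u = {w \<in> N u. w div 2 ^ k = u div 2 ^ k}"

text \<open>
  To merge two blocks, the color classes of the even block choose new colors one after the other,
  then those of the odd block.
\<close>

primrec block_color :: "(nat \<Rightarrow> nat set) \<Rightarrow> nat \<Rightarrow> nat \<Rightarrow> nat \<Rightarrow> nat" where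
  "block_color N d 0 u = 0"
| "block_color N d (Suc k) u = the (greedy (block_nbrs (Suc k) N)
     (\<lambda>w. (w div 2 ^ k mod 2 * Suc d + block_color N d k w, {..d})) (2 * Suc d) u)"

lemma local_block_color: "local_map (k * (2 * Suc d)) (\<lambda>N (p :: nat \<Rightarrow> 'i). block_color N d k)"
proof (induction k)
  case 0
  then show ?case by (auto intro: local_mapI)
next
  case (Suc k)
  let ?q = "\<lambda>N w. (w div 2 ^ k mod 2 * Suc d + block_color N d k w, {..d})"
  have 1: "local_map (k * (2 * Suc d)) (\<lambda>N (p :: nat \<Rightarrow> 'i). ?q N)"
  proof (rule local_mapI)
    fix N N' :: "nat \<Rightarrow> nat set" and p p' :: "nat \<Rightarrow> 'i" and v
    assume "\<And>u. u \<in> nball N (k * (2 * Suc d)) v \<Longrightarrow> N u = N' u \<and> p u = p' u"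
    from local_mapD[OF Suc.IH this] show "?q N v = ?q N' v" by simp
  qed
  have 2: "local_map (2 * Suc d) (\<lambda>N (q :: nat \<Rightarrow> nat \<times> nat set) u. the (greedy (block_nbrs (Suc k) N) q (2 * Suc d) u))"
  proof (rule local_mapI)
    fix N N' :: "nat \<Rightarrow> nat set" and q q' :: "nat \<Rightarrow> nat \<times> nat set" and v
    assume agree: "\<And>u. u \<in> nball N (2 * Suc d) v \<Longrightarrow> N u = N' u \<and> q u = q' u"
    have sub: "nball (block_nbrs (Suc k) N) r v \<subseteq> nball N r v" for r v
      by (induction r arbitrary: v) (force simp: nball.simps(2) block_nbrs_def)+
    show "the (greedy (block_nbrs (Suc k) N) q (2 * Suc d) v) =
        the (greedy (block_nbrs (Suc k) N') q' (2 * Suc d) v)"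
    proof (rule arg_cong[of _ _ the], rule local_mapD[OF local_greedy])
      fix u assume "u \<in> nball (block_nbrs (Suc k) N) (2 * Suc d) v"
      with sub agree have "N u = N' u \<and> q u = q' u" by blast
      then show "block_nbrs (Suc k) N u = block_nbrs (Suc k) N' u \<and> q u = q' u"
        by (simp add: block_nbrs_def)
    qed
  qed
  have "(\<lambda>N (p :: nat \<Rightarrow> 'i). block_color N d (Suc k)) =
      (\<lambda>N p u. the (greedy (block_nbrs (Suc k) N) (?q N) (2 * Suc d) u))"
    by (intro ext) (rule block_color.simps(2))
  moreover have "Suc k * (2 * Suc d) = 2 * Suc d + k * (2 * Suc d)" by (rule mult_Suc)
  ultimately show ?case using local_map_comp[OF 1 2] by (simp only: add.commute)
qed

lemma block_eq_Suc:
  "(w::nat) div 2 ^ Suc k = u div 2 ^ Suc k \<Longrightarrow> w div 2 ^ k mod 2 = u div 2 ^ k mod 2 \<Longrightarrow>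
   w div 2 ^ k = u div 2 ^ k"
  by (metis div_mult_mod_eq div_mult2_eq power_Suc2)

lemma block_eq_SucI: "(w::nat) div 2 ^ k = u div 2 ^ k \<Longrightarrow> w div 2 ^ Suc k = u div 2 ^ Suc k"
  by (metis div_mult2_eq power_Suc2)

text \<open>In a merge the step of a vertex is its old color, at most \<open>d\<close>, plus
  \<open>Suc d\<close> in the odd half. Neighbors in one half differ in the old color, neighbors in
  different halves in the summand. So no two neighbors choose simultaneously, and
  \<open>d + 1\<close> colors suffice.\<close>

lemma block_color:
  assumes "nbr_graph N V d"
  shows "u \<in> V \<Longrightarrow> block_color N d k u \<le> d"
    and "w \<in> block_nbrs k N u \<Longrightarrow> block_color N d k w \<noteq> block_color N d k u"
proof -
  interpret nbr_graph N V d by fact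
  have "(\<forall>u\<in>V. block_color N d k u \<le> d) \<and>
    (\<forall>u. \<forall>w\<in>block_nbrs k N u. block_color N d k w \<noteq> block_color N d k u)" for k
  proof (induction k)
    case 0
    then show ?case using nbr_irrefl by (auto simp: block_nbrs_def)
  next
    case (Suc k)
    define M where "M = block_nbrs (Suc k) N"
    have Msub: "M x \<subseteq> N x" for x by (auto simp: M_def block_nbrs_def)
    interpret M: nbr_graph M V d
    proof
      show "finite V" by (rule finV)
      show "M x \<subseteq> V" for x using Msub nbr_sub by blast
      show "x \<in> M y \<Longrightarrow> y \<in> M x" for x y
        using nbr_sym by (auto simp: M_def block_nbrs_def)
      show "x \<notin> M x" for x using Msub nbr_irrefl by blast
      show "card (M x) \<le> d" for x using card_mono[OF finN Msub[of x]] deg[of x] by linarith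
    qed
    define q where "q w = (w div 2 ^ k mod 2 * Suc d + block_color N d k w, {..d})" for w
    let ?T = "2 * Suc d"
    have bc: "block_color N d (Suc k) w = the (greedy M q ?T w)" for w
      by (simp add: M_def q_def[abs_def])
    have lt: "fst (q w) < ?T" if "w \<in> V" for w
    proof -
      have "w div 2 ^ k mod 2 * Suc d \<le> 1 * Suc d" by (rule mult_right_mono) auto
      moreover have "block_color N d k w \<le> d" using Suc that by blast
      ultimately show ?thesis by (simp add: q_def)
    qed
    have avail: "card {w \<in> M u. fst (q w) < fst (q u)} < card (snd (q u))" for u
    proof -
      have "card {w \<in> M u. fst (q w) < fst (q u)} \<le> card (M u)" by (intro card_mono) auto
      also have "\<dots> \<le> d" by (rule M.deg)
      finally show ?thesis by (simp add: q_def)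
    qed
    have dist: "fst (q u) \<noteq> fst (q w)" if w: "w \<in> M u" for u w
    proof
      assume eq: "fst (q u) = fst (q w)"
      have "u \<in> V" "w \<in> V" using w M.nbr_sub M.nbr_sym by blast+
      then have le: "block_color N d k u < Suc d" "block_color N d k w < Suc d"
        using Suc by (auto simp: less_Suc_eq_le)
      have eq': "block_color N d k u + u div 2 ^ k mod 2 * Suc d =
          block_color N d k w + w div 2 ^ k mod 2 * Suc d"
        using eq by (simp only: q_def fst_conv add.commute)
      have "block_color N d k u = block_color N d k w"
        using arg_cong[OF eq', of "\<lambda>x. x mod Suc d"] le by (simp del: mult_Suc_right)
      moreover have "u div 2 ^ k mod 2 = w div 2 ^ k mod 2"
        using arg_cong[OF eq', of "\<lambda>x. x div Suc d"] le by (simp del: mult_Suc_right)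
      then have "w \<in> block_nbrs k N u"
        using w block_eq_Suc[of w k u] by (auto simp: M_def block_nbrs_def)
      ultimately show False using Suc by metis
    qed
    have snd_q: "snd (q u) = {..d}" for u by (simp add: q_def)
    have some: "\<exists>x\<in>{..d}. greedy M q ?T u = Some x" if "u \<in> V" for u
      using greedy_choice[where N = M and q = q, OF M.finN lt[OF that] avail]
      unfolding snd_q by blast
    show ?case
    proof (intro conjI ballI allI)
      show "block_color N d (Suc k) u \<le> d" if "u \<in> V" for u
        using some[OF that] unfolding bc by (metis atMost_iff option.sel)
      fix u w assume w: "w \<in> block_nbrs (Suc k) N u"
      then have wM: "w \<in> M u" by (simp add: M_def)
      then have "u \<in> V" "w \<in> V" using M.nbr_sub M.nbr_sym by blast+
      then obtain x y where xy: "greedy M q ?T u = Some x" "greedy M q ?T w = Some y"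
        using some by blast
      have "y \<noteq> x" using M.greedy_proper[OF avail dist wM xy(1)] xy(2) by auto
      then show "block_color N d (Suc k) w \<noteq> block_color N d (Suc k) u"
        unfolding bc xy by simp
    qed
  qed
  then show "u \<in> V \<Longrightarrow> block_color N d k u \<le> d"
    "w \<in> block_nbrs k N u \<Longrightarrow> block_color N d k w \<noteq> block_color N d k u" by blast+
qed

text \<open>A ruling set built bit by bit: in a merge the candidates of the even half stay, and one
  of the odd half is dropped if an even one is within distance \<open>a\<close>. Distances are those
  of the whole graph, not of the block.\<close>

primrec ruling :: "(nat \<Rightarrow> nat set) \<Rightarrow> nat \<Rightarrow> nat \<Rightarrow> nat \<Rightarrow> bool" where
  "ruling N a 0 u = True"
| "ruling N a (Suc k) u = (ruling N a k u \<and> (even (u div 2 ^ k) \<or>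
     \<not> (\<exists>w\<in>nball N a u. ruling N a k w \<and> even (w div 2 ^ k) \<and> w div 2 ^ Suc k = u div 2 ^ Suc k)))"

lemma local_ruling: "local_map (k * a) (\<lambda>N p. ruling N a k)"
proof (induction k)
  case 0
  then show ?case by (auto intro: local_mapI)
next
  case (Suc k)
  have "local_map a (\<lambda>N S (u::nat). S u \<and> (even (u div 2 ^ k) \<or>
     \<not> (\<exists>w\<in>nball N a u. S w \<and> even (w div 2 ^ k) \<and> w div 2 ^ Suc k = u div 2 ^ Suc k)))"
    (is "local_map a ?H")
  proof (rule local_mapI)
    fix N N' :: "nat \<Rightarrow> nat set" and S S' :: "nat \<Rightarrow> bool" and v
    assume agree: "\<And>u. u \<in> nball N a v \<Longrightarrow> N u = N' u \<and> S u = S' u"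
    have "nball N a v = nball N' a v" using agree by (intro nball_cong) blast
    moreover have "S u = S' u" if "u \<in> nball N a v" for u using agree that by blast
    ultimately show "?H N S v = ?H N' S' v" by (metis center_in_nball)
  qed
  from local_map_comp[OF Suc.IH this] show ?case by (simp add: add.commute)
qed

text \<open>Two survivors at distance at most \<open>a\<close> lie in the same half, since otherwise
  the odd one would have been dropped; so the smaller block already separates them.\<close>

lemma ruling_far:
  assumes "nbr_graph N V d"
  shows "ruling N a k u \<Longrightarrow> ruling N a k w \<Longrightarrow> u div 2 ^ k = w div 2 ^ k \<Longrightarrow> w \<in> nball N a u \<Longrightarrow> u = w"
proof (induction k arbitrary: u w)
  case 0
  then show ?case by simp
next
  case (Suc k)
  interpret nbr_graph N V d by fact
  have sym: "u \<in> nball N a w" using Suc.prems nball_sym by blast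
  have "even (u div 2 ^ k) \<longleftrightarrow> even (w div 2 ^ k)"
    using Suc.prems sym unfolding ruling.simps by metis
  then have "u div 2 ^ k mod 2 = w div 2 ^ k mod 2"
    by (simp add: mod2_eq_if)
  then show ?case using Suc block_eq_Suc[of u k w] by auto
qed

text \<open>Each merge costs at most \<open>a\<close>: a dropped candidate is replaced by the even
  one that caused the drop, which survives.\<close>

lemma ruling_dominates:
  "\<exists>w\<in>nball N (k * a) u. ruling N a k w \<and> w div 2 ^ k = u div 2 ^ k"
proof (induction k)
  case (Suc k)
  then obtain w where w: "w \<in> nball N (k * a) u" "ruling N a k w" "w div 2 ^ k = u div 2 ^ k"
    by blast
  show ?case
  proof (cases "ruling N a (Suc k) w")
    case True
    moreover have "w \<in> nball N (Suc k * a) u"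
      using w(1) nball_mono[of "k * a" "Suc k * a" N u] by auto
    ultimately show ?thesis using block_eq_SucI[OF w(3)] by blast
  next
    case False
    then obtain w' where w': "w' \<in> nball N a w" "ruling N a k w'" "even (w' div 2 ^ k)"
      "w' div 2 ^ Suc k = w div 2 ^ Suc k" using w by auto
    have "w' \<in> nball N (Suc k * a) u"
      using nball_add[OF w(1) w'(1)] by (simp add: add.commute)
    moreover have "ruling N a (Suc k) w'" using w' by simp
    ultimately show ?thesis using block_eq_SucI[OF w(3)] w' by metis
  qed
qed simp


section \<open>Repairing the uncolored vertices\<close>

definition repair_ok ::
  "('a \<Rightarrow> 'a set) \<Rightarrow> nat \<Rightarrow> ('a \<Rightarrow> 'c set \<times> 'c option) \<Rightarrow> 'a \<Rightarrow> ('a \<Rightarrow> 'c) \<Rightarrow> bool" where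
  "repair_ok N R q v f \<longleftrightarrow> (\<forall>x\<in>nball N R v. f x \<in> fst (q x) \<and>
     (\<forall>y\<in>N x. if y \<in> nball N R v then f x \<noteq> f y else snd (q y) \<noteq> Some (f x)))"

text \<open>The vertices without a color are so far apart that each vertex sees at most one of them.\<close>

definition repair :: "nat \<Rightarrow> ('a \<Rightarrow> 'a set) \<Rightarrow> ('a \<Rightarrow> 'c set \<times> 'c option) \<Rightarrow> 'a \<Rightarrow> 'c answer" where
  "repair R N q u =
    (if \<exists>v\<in>nball N R u. snd (q v) = None then
       let v = SOME v. v \<in> nball N R u \<and> snd (q v) = None
       in if \<exists>f. repair_ok N R q v f then Color ((SOME f. repair_ok N R q v f) u) else No_Coloring
     else Color (the (snd (q u))))"

text \<open>A root within distance \<open>R\<close> has its ball within \<open>2 * R\<close>, and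
  \<open>repair_ok\<close> also reads the colors of the neighbors of that ball.\<close>

lemma local_repair: "local_map (2 * R + 1) (repair R)"
proof (rule local_mapI)
  fix N N' :: "'a \<Rightarrow> 'a set" and q q' :: "'a \<Rightarrow> 'b set \<times> 'b option" and u
  assume agree: "\<And>x. x \<in> nball N (2 * R + 1) u \<Longrightarrow> N x = N' x \<and> q x = q' x"
  have near: "x \<in> nball N (2 * R + 1) u" if "v \<in> nball N R u" "x \<in> nball N k v" "k \<le> R + 1" for v x k
    using nball_add[OF that(1,2)] nball_mono[of "R + k" "2 * R + 1" N u] that(3) by auto
  have ballR: "nball N R u = nball N' R u"
    using agree near[OF center_in_nball] by (intro nball_cong) auto
  have q: "q v = q' v" if "v \<in> nball N R u" for v
    using agree[OF near[OF that, of v 0]] by simp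
  have ok: "repair_ok N R q v f \<longleftrightarrow> repair_ok N' R q' v f" if v: "v \<in> nball N R u" for v f
  proof -
    have B: "nball N R v = nball N' R v"
      using agree near[OF v] by (intro nball_cong) auto
    have "N x = N' x \<and> q x = q' x \<and> (\<forall>y\<in>N x. q y = q' y)" if "x \<in> nball N R v" for x
      using agree near[OF v, of _ "Suc R"] near[OF v, of _ R] nbr_in_nball[where N = N, OF that] that by auto
    then show ?thesis unfolding repair_ok_def B[symmetric] by auto
  qed
  show "repair R N q u = repair R N' q' u"
  proof (cases "\<exists>v\<in>nball N R u. snd (q v) = None")
    case True
    define v where "v = (SOME v. v \<in> nball N R u \<and> snd (q v) = None)"
    have v: "v \<in> nball N R u" unfolding v_def using True someI_ex[of "\<lambda>v. v \<in> nball N R u \<and> snd (q v) = None"] by blast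
    have "(\<lambda>v. v \<in> nball N' R u \<and> snd (q' v) = None) = (\<lambda>v. v \<in> nball N R u \<and> snd (q v) = None)"
      using ballR q by auto
    then have v': "v = (SOME v. v \<in> nball N' R u \<and> snd (q' v) = None)" by (simp add: v_def)
    have True': "\<exists>v\<in>nball N' R u. snd (q' v) = None" using True ballR q by auto
    have ok': "repair_ok N R q v = repair_ok N' R q' v" using ok[OF v] by auto
    show ?thesis using True True'
      by (simp add: repair_def Let_def v_def[symmetric] v'[symmetric] ok')
  next
    case False
    have False': "\<not> (\<exists>v\<in>nball N' R u. snd (q' v) = None)" using False ballR q by auto
    show ?thesis unfolding repair_def if_not_P[OF False] if_not_P[OF False'] using q[of u] by simp
  qed
qed

text \<open>The distance to \<open>S\<close> truncated at \<open>b\<close>: the disjunct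
  \<open>j = b\<close> makes the minimum exist and keeps the search within radius
  \<open>b\<close>.\<close>

definition distance_to :: "nat \<Rightarrow> ('a \<Rightarrow> 'a set) \<Rightarrow> ('a \<Rightarrow> bool) \<Rightarrow> 'a \<Rightarrow> nat" where
  "distance_to b N S u = (LEAST j. j = b \<or> (\<exists>w\<in>nball N j u. S w))"

lemma distance_to_le: "distance_to b N S u \<le> b"
  unfolding distance_to_def by (rule Least_le) simp

lemma local_distance_to: "local_map b (distance_to b)"
proof (rule local_mapI)
  fix N N' :: "'a \<Rightarrow> 'a set" and S S' :: "'a \<Rightarrow> bool" and u
  assume agree: "\<And>x. x \<in> nball N b u \<Longrightarrow> N x = N' x \<and> S x = S' x"
  have step: "(\<exists>w\<in>nball N j u. S w) \<longleftrightarrow> (\<exists>w\<in>nball N' j u. S' w)" if "j \<le> b" for j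
  proof -
    have sub: "x \<in> nball N b u" if "x \<in> nball N j u" for x using nball_mono[OF \<open>j \<le> b\<close>, of N u] that by blast
    have "nball N j u = nball N' j u" using agree sub by (intro nball_cong) auto
    then show ?thesis using agree sub by blast
  qed
  have le: "distance_to b N S u \<le> b" "distance_to b N' S' u \<le> b" by (rule distance_to_le)+
  have "distance_to b N S u \<le> distance_to b N' S' u"
  proof -
    have "distance_to b N' S' u = b \<or> (\<exists>w\<in>nball N' (distance_to b N' S' u) u. S' w)"
      unfolding distance_to_def by (rule LeastI[of _ b]) simp
    then show ?thesis using step[OF le(2)] unfolding distance_to_def[of b N S u] by (intro Least_le) auto
  qed
  moreover have "distance_to b N' S' u \<le> distance_to b N S u"
  proof -
    have "distance_to b N S u = b \<or> (\<exists>w\<in>nball N (distance_to b N S u) u. S w)"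
      unfolding distance_to_def by (rule LeastI[of _ b]) simp
    then show ?thesis using step[OF le(1)] unfolding distance_to_def[of b N' S' u] by (intro Least_le) auto
  qed
  ultimately show "distance_to b N S u = distance_to b N' S' u" by (rule antisym)
qed

lemma local_map_pointwise: "local_map r F \<Longrightarrow> local_map r (\<lambda>N p u. g u (F N p u))"
  unfolding local_map_def by metis

section \<open>Parameters and composition of the phases\<close>

definition bits :: "nat \<Rightarrow> nat" where
  "bits n = (LEAST m. n < 2 ^ m)"

lemma less_two_pow_bits: "n < 2 ^ bits n"
  unfolding bits_def by (rule LeastI[of _ n]) (rule less_exp)

text \<open>The radius at which \<open>exponential_growth\<close> would yield
  \<open>2 ^ bits n\<close> vertices, more than \<open>n\<close>.\<close>

definition repair_radius :: "nat \<Rightarrow> nat" where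
  "repair_radius n = 2 * bits n + 1"

text \<open>Roots farther apart than this have repair balls that are disjoint and not joined by an
  edge.\<close>

definition separation :: "nat \<Rightarrow> nat" where
  "separation n = 2 * repair_radius n + 1"

definition domination :: "nat \<Rightarrow> nat" where
  "domination n = bits n * separation n"

definition is_root :: "nat \<Rightarrow> (nat \<Rightarrow> nat set) \<Rightarrow> nat \<Rightarrow> bool" where
  "is_root n N = ruling N (separation n) (bits n)"

text \<open>Far vertices come first, and the block color, below \<open>Suc d\<close>, orders those
  of equal distance. Roots have distance 0 and so a step of at least
  \<open>domination n * Suc d\<close>, when \<open>partial_coloring\<close> has stopped.\<close>

definition schedule :: "nat \<Rightarrow> nat \<Rightarrow> (nat \<Rightarrow> nat set) \<Rightarrow> nat \<Rightarrow> nat" where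
  "schedule n d N u =
     (domination n - distance_to (domination n) N (is_root n N) u) * Suc d + block_color N d (bits n) u"

definition partial_coloring ::
  "nat \<Rightarrow> nat \<Rightarrow> (nat \<Rightarrow> nat set) \<Rightarrow> (nat \<Rightarrow> 'c set) \<Rightarrow> nat \<Rightarrow> 'c option" where
  "partial_coloring n d N P = greedy N (\<lambda>u. (schedule n d N u, P u)) (domination n * Suc d)"

definition solution :: "nat \<Rightarrow> nat \<Rightarrow> (nat \<Rightarrow> nat set) \<Rightarrow> (nat \<Rightarrow> 'c set) \<Rightarrow> nat \<Rightarrow> 'c answer" where
  "solution n d N P = repair (repair_radius n) N (\<lambda>u. (P u, partial_coloring n d N P u))"

text \<open>In order: the block coloring, the ruling set and the distances to it
  (\<open>domination n\<close> each), the greedy coloring, the repair.\<close>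

definition rounds :: "nat \<Rightarrow> nat \<Rightarrow> nat" where
  "rounds n d = bits n * (2 * Suc d) + 2 * domination n + domination n * Suc d + (2 * repair_radius n + 1)"

lemma local_schedule:
  "local_map (bits n * (2 * Suc d) + 2 * domination n) (\<lambda>N (p :: nat \<Rightarrow> 'i). schedule n d N)"
proof -
  let ?s = "bits n * (2 * Suc d) + 2 * domination n"
  have "local_map (domination n) (\<lambda>N (p :: nat \<Rightarrow> 'i). is_root n N)"
    unfolding is_root_def domination_def by (rule local_ruling)
  from local_map_comp[OF this local_distance_to[of "domination n"]]
  have 1: "local_map ?s (\<lambda>N (p :: nat \<Rightarrow> 'i). distance_to (domination n) N (is_root n N))"
    by (rule local_map_mono) simp
  have 2: "local_map ?s (\<lambda>N (p :: nat \<Rightarrow> 'i). block_color N d (bits n))"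
    by (rule local_map_mono[OF local_block_color]) simp
  from local_map_pointwise[OF local_map_Pair[OF 1 2],
    of "\<lambda>u x. (domination n - fst x) * Suc d + snd x"]
  show ?thesis unfolding schedule_def[abs_def] by simp
qed

lemma local_solution: "local_map (rounds n d) (solution n d)"
proof -
  let ?s = "bits n * (2 * Suc d) + 2 * domination n"
  have input: "local_map r (\<lambda>N (p :: nat \<Rightarrow> 'c set). p)" for r
    by (rule local_map_input)
  from local_map_comp[OF local_map_Pair[OF local_schedule[where d = d] input] local_greedy]
  have "local_map (?s + domination n * Suc d) (partial_coloring n d)"
    unfolding partial_coloring_def[abs_def] .
  from local_map_comp[OF local_map_Pair[OF input this] local_repair]
  show ?thesis unfolding solution_def[abs_def] rounds_def .
qed

section \<open>Correctness on graphs whose vertices are identifiers\<close>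

locale coloring_instance = nbr_graph N V d for N :: "nat \<Rightarrow> nat set" and V d +
  fixes P :: "nat \<Rightarrow> 'c set" and n :: nat
  assumes d3: "3 \<le> d" and n: "n = card V"
    and ids: "u \<in> V \<Longrightarrow> u \<le> n"
    and lists: "u \<in> V \<Longrightarrow> infinite (P u) \<or> d \<le> card (P u)"
begin

abbreviation "R \<equiv> repair_radius n"
abbreviation "b \<equiv> domination n"
abbreviation "T \<equiv> b * Suc d"
abbreviation "D \<equiv> distance_to b N (is_root n N)"
abbreviation "\<tau> \<equiv> schedule n d N"
abbreviation "c \<equiv> partial_coloring n d N P"

lemma block_0: "u \<in> V \<Longrightarrow> u div 2 ^ bits n = 0"
  using ids[of u] less_two_pow_bits[of n] by simp

lemma nball_V: "u \<in> V \<Longrightarrow> nball N r u \<subseteq> V"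
  using nball_closed[of V N u] nbr_sub by blast

lemma roots_far: "is_root n N u \<Longrightarrow> is_root n N w \<Longrightarrow> u \<in> V \<Longrightarrow> w \<in> nball N (separation n) u \<Longrightarrow> u = w"
  using ruling_far[OF nbr_graph_axioms, of "separation n" "bits n" u w] block_0 nball_V[of u "separation n"]
  unfolding is_root_def by (auto simp: subset_iff)

lemma root_in_distance: "\<exists>w\<in>nball N (D u) u. is_root n N w"
proof -
  have "D u = b \<or> (\<exists>w\<in>nball N (D u) u. is_root n N w)"
    unfolding distance_to_def by (rule LeastI[of _ b]) simp
  moreover have "\<exists>w\<in>nball N b u. is_root n N w"
    using ruling_dominates[of N "bits n" "separation n" u] unfolding is_root_def domination_def by blast
  ultimately show ?thesis by auto
qed

lemma D_le: "w \<in> nball N j u \<Longrightarrow> is_root n N w \<Longrightarrow> D u \<le> j"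
  unfolding distance_to_def by (rule Least_le) blast

lemma D_0_iff: "D u = 0 \<longleftrightarrow> is_root n N u"
  using root_in_distance[of u] D_le[of u 0 u] by auto

lemma D_descent:
  assumes "D u \<noteq> 0"
  obtains w where "w \<in> N u" "D w < D u"
proof -
  obtain j where j: "D u = Suc j" using assms not0_implies_Suc by blast
  obtain r where r: "r \<in> nball N (Suc j) u" "is_root n N r" using root_in_distance[of u] j by auto
  have "r \<noteq> u" using r D_0_iff assms by auto
  then obtain w where "w \<in> N u" "r \<in> nball N j w" using r by (auto simp: nball.simps(2))
  then show thesis using that[of w] D_le[of r j w] r j by auto
qed

lemma block_color_lt: "u \<in> V \<Longrightarrow> block_color N d (bits n) u < Suc d"
  using block_color(1)[OF nbr_graph_axioms] by (simp add: less_Suc_eq_le)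

lemma schedule_mono: "u \<in> V \<Longrightarrow> D w < D u \<Longrightarrow> \<tau> u < \<tau> w"
proof -
  assume u: "u \<in> V" and lt: "D w < D u"
  have "\<tau> u < (b - D u) * Suc d + Suc d" using block_color_lt[OF u] by (simp add: schedule_def)
  also have "\<dots> = Suc (b - D u) * Suc d" by simp
  also have "\<dots> \<le> (b - D w) * Suc d"
    using lt distance_to_le[of b N "is_root n N" u] by (intro mult_right_mono) auto
  also have "\<dots> \<le> \<tau> w" by (simp add: schedule_def)
  finally show ?thesis .
qed

lemma schedule_lt_iff: "u \<in> V \<Longrightarrow> \<tau> u < T \<longleftrightarrow> \<not> is_root n N u"
proof -
  assume u: "u \<in> V"
  show ?thesis
  proof
    assume lt: "\<tau> u < T"
    show "\<not> is_root n N u"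
    proof
      assume "is_root n N u"
      then have "D u = 0" by (simp add: D_0_iff)
      then have "T \<le> \<tau> u" unfolding schedule_def by simp
      then show False using lt by simp
    qed
  next
    assume "\<not> is_root n N u"
    then have "D u \<noteq> 0" by (simp add: D_0_iff)
    then have le: "Suc (b - D u) \<le> b" using distance_to_le[of b N "is_root n N" u] by linarith
    have "\<tau> u < (b - D u) * Suc d + Suc d" using block_color_lt[OF u] by (simp add: schedule_def)
    also have "\<dots> = Suc (b - D u) * Suc d" by simp
    also have "\<dots> \<le> T" using le by (rule mult_right_mono) simp
    finally show "\<tau> u < T" .
  qed
qed

text \<open>The step modulo \<open>Suc d\<close> is the block color, and at level
  \<open>bits n\<close> all identifiers lie in one block.\<close>

lemma schedule_neq:
  assumes w: "w \<in> N u"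
  shows "\<tau> u \<noteq> \<tau> w"
proof
  assume eq: "\<tau> u = \<tau> w"
  have V: "u \<in> V" "w \<in> V" using w nbr_sub nbr_sym by blast+
  have "\<tau> x mod Suc d = block_color N d (bits n) x" if "x \<in> V" for x
    using block_color_lt[OF that] unfolding schedule_def by (simp del: mult_Suc_right)
  then have "block_color N d (bits n) u = block_color N d (bits n) w" using eq V by metis
  moreover have "w \<in> block_nbrs (bits n) N u" using w V block_0 by (simp add: block_nbrs_def)
  ultimately show False using block_color(2)[OF nbr_graph_axioms] by metis
qed

text \<open>A vertex that is not a root has a neighbor closer to the roots, which is scheduled
  later; so at most \<open>d - 1\<close> neighbors are colored before it.\<close>

lemma available:
  assumes u: "u \<in> V" "\<tau> u < T" and fin: "finite (P u)"
  shows "card {w \<in> N u. \<tau> w < \<tau> u} < card (P u)"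
proof -
  have "D u \<noteq> 0" using u schedule_lt_iff D_0_iff by simp
  then obtain w where w: "w \<in> N u" "D w < D u" by (rule D_descent)
  then have "w \<notin> {w \<in> N u. \<tau> w < \<tau> u}" using schedule_mono[OF u(1)] by force
  with w have "{w \<in> N u. \<tau> w < \<tau> u} \<subset> N u" by blast
  then have "card {w \<in> N u. \<tau> w < \<tau> u} < card (N u)" by (intro psubset_card_mono) auto
  also have "\<dots> \<le> card (P u)" using deg[of u] lists[OF u(1)] fin by auto
  finally show ?thesis .
qed

lemma partial_None_iff: "u \<in> V \<Longrightarrow> c u = None \<longleftrightarrow> is_root n N u"
  using schedule_lt_iff[of u] greedy_None_iff[of N "\<lambda>u. (\<tau> u, P u)" T u]
  by (auto simp: partial_coloring_def)

lemma partial_list: "u \<in> V \<Longrightarrow> c u = Some x \<Longrightarrow> x \<in> P u"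
proof -
  assume u: "u \<in> V" and x: "c u = Some x"
  then have "\<not> is_root n N u" using partial_None_iff[OF u] by simp
  then have lt: "\<tau> u < T" using schedule_lt_iff[OF u] by blast
  show ?thesis
    using greedy_choice[where N = N and q = "\<lambda>u. (\<tau> u, P u)" and t = T and u = u] available[OF u lt] lt x
    by (auto simp del: greedy.simps simp: partial_coloring_def)
qed

lemma partial_proper: "w \<in> N u \<Longrightarrow> c u = Some x \<Longrightarrow> c w \<noteq> Some x"
  using greedy_proper[where q = "\<lambda>u. (\<tau> u, P u)" and t = T and u = u and w = w and x = x]
    available schedule_neq
  by (auto simp del: greedy.simps simp: partial_coloring_def)

abbreviation "state \<equiv> \<lambda>u. (P u, c u)"

text \<open>Otherwise the ball would be a \<open>stuck_ball\<close>, and by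
  \<open>exponential_growth\<close> the graph would have more than \<open>n\<close>
  vertices.\<close>

lemma repairable_or_closed:
  assumes v: "v \<in> V" "is_root n N v"
  shows "(\<exists>f. repair_ok N R state v f) \<or> (\<forall>x\<in>nball N R v. N x \<subseteq> nball N R v)"
proof (rule ccontr)
  assume neg: "\<not> ?thesis"
  let ?B = "nball N R v"
  have BV: "?B \<subseteq> V" by (rule nball_V[OF v(1)])
  \<comment> \<open>Colors outside the ball stay fixed, so those seen by \<open>x\<close> are
    removed from its list.\<close>
  define L where "L x = P x - (\<lambda>w. the (c w)) ` {w \<in> N x - ?B. c w \<noteq> None}" for x
  have colored: "c x \<noteq> None" if x: "x \<in> ?B - {v}" for x
  proof
    assume "c x = None"
    then have "is_root n N x" using x BV partial_None_iff by auto
    moreover have "x \<in> nball N (separation n) v"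
      using x nball_mono[of R "separation n" N v] by (auto simp: separation_def)
    ultimately show False using roots_far[OF v(2) _ v(1)] x by auto
  qed
  have n0: "0 < n" unfolding n using v finV by (auto simp: card_gt_0_iff)
  have bits0: "0 < bits n" using less_two_pow_bits[of n] n0 by (cases "bits n") auto
  interpret stuck_ball N V d L "\<lambda>x. the (c x)" v R
  proof
    show "3 \<le> d" by (rule d3)
    show "v \<in> V" by (rule v(1))
    show "2 \<le> R" using bits0 by (simp add: repair_radius_def)
    show "\<not> (\<forall>x\<in>?B. N x \<subseteq> ?B)" using neg by blast
    show "d \<le> card (L x) + card (N x - ?B)" if x: "x \<in> ?B" and fin: "finite (L x)" for x
    proof -
      let ?A = "{w \<in> N x - ?B. c w \<noteq> None}"
      let ?F = "(\<lambda>w. the (c w)) ` ?A"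
      have finA: "finite ?A" by simp
      have "finite (P x)"
        using fin finite_Diff2[of ?F "P x"] finA unfolding L_def by blast
      then have "d \<le> card (P x)" using lists x BV by blast
      also have "\<dots> \<le> card (L x) + card ?F"
        using diff_card_le_card_Diff[of ?F "P x"] finA unfolding L_def by simp
      also have "card ?F \<le> card ?A" by (rule card_image_le[OF finA])
      also have "card ?A \<le> card (N x - ?B)" by (rule card_mono) auto
      finally show ?thesis by simp
    qed
    show "the (c x) \<in> L x" if x: "x \<in> ?B - {v}" for x
    proof -
      obtain y where y: "c x = Some y" using colored[OF x] by auto
      have "y \<noteq> the (c w)" if "w \<in> N x" "c w \<noteq> None" for w
        using partial_proper[OF that(1) y] that(2) by auto
      then show ?thesis using partial_list[of x y] y x BV by (auto simp: L_def)
    qed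
    show "the (c x) \<noteq> the (c y)" if x: "x \<in> ?B - {v}" and y: "y \<in> N x \<inter> ?B - {v}" for x y
      using partial_proper[of y x] colored[OF x] colored[of y] y by auto
    show "\<nexists>f. \<forall>x\<in>?B. f x \<in> L x \<and> (\<forall>y\<in>N x \<inter> ?B. f x \<noteq> f y)"
    proof
      assume "\<exists>f. \<forall>x\<in>?B. f x \<in> L x \<and> (\<forall>y\<in>N x \<inter> ?B. f x \<noteq> f y)"
      then obtain f where f: "\<And>x. x \<in> ?B \<Longrightarrow> f x \<in> L x" "\<And>x y. x \<in> ?B \<Longrightarrow> y \<in> N x \<Longrightarrow> y \<in> ?B \<Longrightarrow> f x \<noteq> f y"
        by blast
      have "c y \<noteq> Some (f x)" if "x \<in> ?B" "y \<in> N x" "y \<notin> ?B" for x y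
      proof
        assume "c y = Some (f x)"
        then have "f x \<in> (\<lambda>w. the (c w)) ` {w \<in> N x - ?B. c w \<noteq> None}"
          using that by (intro image_eqI[of _ _ y]) auto
        then show False using f(1)[OF that(1)] by (simp add: L_def)
      qed
      then have "repair_ok N R state v f"
        using f unfolding repair_ok_def L_def by auto
      then show False using neg by blast
    qed
  qed
  have "2 ^ bits n \<le> card V" by (rule exponential_growth) (simp add: repair_radius_def)
  then show False using less_two_pow_bits[of n] n by simp
qed

lemma near_root_unique:
  assumes "u \<in> V" "v \<in> nball N R u" "c v = None" "w \<in> nball N R u" "c w = None"
  shows "v = w"
proof -
  have V: "v \<in> V" "w \<in> V" using assms nball_V by blast+
  have "w \<in> nball N (R + R) v" using nball_add[OF nball_sym] assms by blast
  then have "w \<in> nball N (separation n) v"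
    using nball_mono[of "R + R" "separation n" N v] by (auto simp: separation_def)
  then show ?thesis using roots_far partial_None_iff V assms by metis
qed

lemma solution_near_root:
  assumes "u \<in> V" "v \<in> nball N R u" "c v = None"
  shows "solution n d N P u = (if \<exists>f. repair_ok N R state v f
    then Color ((SOME f. repair_ok N R state v f) u) else No_Coloring)"
proof -
  have "(SOME w. w \<in> nball N R u \<and> c w = None) = v"
    using assms near_root_unique by (intro some_equality) blast+
  then show ?thesis using assms by (auto simp: solution_def repair_def)
qed

lemma solution_away:
  assumes "\<And>v. v \<in> nball N R u \<Longrightarrow> c v \<noteq> None"
  shows "solution n d N P u = Color (the (c u))"
proof -
  have "\<not> (\<exists>v\<in>nball N R u. snd (P v, c v) = None)" using assms by auto
  then show ?thesis unfolding solution_def repair_def by (simp only: if_False snd_conv)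
qed

text \<open>The set \<open>B\<close> is the ball of an unrepairable root. Closure under neighbors
  replaces connectedness: everything reachable from \<open>v\<close> stays in
  \<open>B\<close>.\<close>

theorem solution_correct:
  "(\<exists>f. \<forall>u\<in>V. solution n d N P u = Color (f u) \<and> f u \<in> P u \<and> (\<forall>w\<in>N u. f u \<noteq> f w)) \<or>
   (\<nexists>f. \<forall>u\<in>V. f u \<in> P u \<and> (\<forall>w\<in>N u. f u \<noteq> f w)) \<and>
   (\<exists>v\<in>V. \<exists>B. v \<in> B \<and> (\<forall>u\<in>B. N u \<subseteq> B \<and> solution n d N P u = No_Coloring))"
proof (cases "\<forall>v\<in>V. c v = None \<longrightarrow> (\<exists>f. repair_ok N R state v f)")
  case True
  define F where "F v = (SOME f. repair_ok N R state v f)" for v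
  have F: "repair_ok N R state v (F v)" if "v \<in> V" "c v = None" for v
    unfolding F_def using someI_ex[of "repair_ok N R state v"] True that by blast
  \<comment> \<open>On \<open>V\<close> all answers are colors in this case, so
    \<open>undefined\<close> does not occur there.\<close>
  define f where "f u = (case solution n d N P u of Color x \<Rightarrow> x | No_Coloring \<Rightarrow> undefined)" for u
  have near: "solution n d N P u = Color (F v u) \<and> f u = F v u"
    if "u \<in> V" "v \<in> nball N R u" "c v = None" for u v
  proof -
    have "v \<in> V" using that nball_V by blast
    then have "\<exists>f. repair_ok N R state v f" using True that by blast
    then show ?thesis using solution_near_root[OF that] by (simp add: f_def F_def)
  qed
  have away: "solution n d N P u = Color (the (c u)) \<and> f u = the (c u) \<and> c u \<noteq> None"
    if "\<forall>v \<in> nball N R u. c v \<noteq> None" for u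
    using solution_away[of u] that by (simp add: f_def)
  have "solution n d N P u = Color (f u) \<and> f u \<in> P u \<and> (\<forall>w\<in>N u. f u \<noteq> f w)" if u: "u \<in> V" for u
  proof -
    \<comment> \<open>An edge leaving a repaired ball ends at a vertex in no other repaired ball, as
      two roots joined by a walk of length \<open>Suc R + R\<close> coincide. That end keeps its
      partial color, which \<open>repair_ok\<close> avoids.\<close>
    have cross: "f x \<noteq> f y" if xy: "x \<in> V" "y \<in> N x" and v: "v \<in> nball N R x" "c v = None" for x y v
    proof -
      have yV: "y \<in> V" and vV: "v \<in> V" using xy v nbr_sub nball_V by blast+
      have xB: "x \<in> nball N R v" using v nball_sym by blast
      show ?thesis
      proof (cases "y \<in> nball N R v")
        case True
        then have "v \<in> nball N R y" using nball_sym by blast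
        then show ?thesis
          using near[OF xy(1) v] near[OF yV _ v(2)] F[OF vV v(2)] xB True xy(2)
          by (auto simp: repair_ok_def)
      next
        case False
        have "c w \<noteq> None" if w: "w \<in> nball N R y" for w
        proof
          assume cw: "c w = None"
          have wV: "w \<in> V" using w nball_V[OF yV] by blast
          have "y \<in> nball N (Suc R) v" using nbr_in_nball[where N = N, OF xB xy(2)] .
          then have "w \<in> nball N (Suc R + R) v" using nball_add w by fast
          then have "w \<in> nball N (separation n) v" by (simp add: separation_def mult_2)
          then have "v = w"
            using roots_far[of v w] partial_None_iff vV wV v cw by simp
          then show False using False nball_sym w by blast
        qed
        then have "f y = the (c y) \<and> c y \<noteq> None" using away by blast
        moreover have "c y \<noteq> Some (F v x)"
        proof -
          have "if y \<in> nball N R v then F v x \<noteq> F v y else snd (state y) \<noteq> Some (F v x)"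
            using F[OF vV v(2)] xB xy(2) unfolding repair_ok_def by blast
          then show ?thesis using False by simp
        qed
        ultimately show ?thesis using near[OF xy(1) v] by auto
      qed
    qed
    show ?thesis
    proof (cases "\<exists>v\<in>nball N R u. c v = None")
      case True
      then obtain v where v: "v \<in> nball N R u" "c v = None" by blast
      have "u \<in> nball N R v" "v \<in> V" using v u nball_sym nball_V by blast+
      then have "F v u \<in> P u" using F[of v] v by (auto simp: repair_ok_def)
      then show ?thesis using near[OF u v] cross[OF u _ v] by auto
    next
      case False
      then have "\<forall>v\<in>nball N R u. c v \<noteq> None" by simp
      from away[OF this] have fu: "solution n d N P u = Color (the (c u))" "f u = the (c u)" "c u \<noteq> None"
        by blast+
      have "f u \<noteq> f w" if w: "w \<in> N u" for w
      proof (cases "\<exists>v\<in>nball N R w. c v = None")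
        case True
        then obtain v where v: "v \<in> nball N R w" "c v = None" by blast
        have "w \<in> V" "u \<in> N w" using w nbr_sub nbr_sym by auto
        from cross[OF this v] show ?thesis by simp
      next
        case False
        then have "\<forall>v\<in>nball N R w. c v \<noteq> None" by simp
        from away[OF this] have "f w = the (c w)" "c w \<noteq> None" by blast+
        then show ?thesis using fu partial_proper[OF w] by auto
      qed
      then show ?thesis using fu partial_list[OF u] by auto
    qed
  qed
  then show ?thesis by blast
next
  case False
  then obtain v where v: "v \<in> V" "c v = None" "\<nexists>f. repair_ok N R state v f" by blast
  have closed: "\<forall>x\<in>nball N R v. N x \<subseteq> nball N R v"
    using repairable_or_closed[of v] partial_None_iff v by blast
  have BV: "nball N R v \<subseteq> V" by (rule nball_V[OF v(1)])
  \<comment> \<open>In a closed ball \<open>repair_ok\<close> imposes nothing from outside, so any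
    list coloring of the graph would be a repair.\<close>
  have "\<not> (\<forall>u\<in>V. f u \<in> P u \<and> (\<forall>w\<in>N u. f u \<noteq> f w))" for f
  proof
    assume "\<forall>u\<in>V. f u \<in> P u \<and> (\<forall>w\<in>N u. f u \<noteq> f w)"
    then have "repair_ok N R state v f" using closed BV unfolding repair_ok_def by auto
    then show False using v by blast
  qed
  moreover have "solution n d N P u = No_Coloring" if "u \<in> nball N R v" for u
  proof -
    have "u \<in> V" "v \<in> nball N R u" using that BV nball_sym by auto
    from solution_near_root[OF this v(2)] v(3) show ?thesis by (simp only: if_False)
  qed
  ultimately show ?thesis
    using closed by (intro disjI2 conjI bexI[OF _ v(1)] exI[of _ "nball N R v"]) auto
qed

end


section \<open>The algorithm\<close>

text \<open>The knowledge of a node after \<open>t\<close> rounds: a header of five entries, then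
  the previous views of its neighbors. \<open>SOME\<close> turns their multiset into a list
  depending on the multiset alone. The round number tells a node when to decide.\<close>

primrec view :: "nat \<Rightarrow> nat \<Rightarrow> (nat \<Rightarrow> nat set) \<Rightarrow> (nat \<Rightarrow> 'c set) \<Rightarrow> nat \<Rightarrow> nat \<Rightarrow> 'c knowledge" where
  "view n d N P 0 i = Tree [Number 0, Number n, Number d, Number i, Palette (P i)]"
| "view n d N P (Suc t) i = Tree (Number (Suc t) # Number n # Number d # Number i # Palette (P i) #
     (SOME l. mset l = image_mset (view n d N P t) (mset_set (N i))))"

lemma view_own:
  assumes "view n d N P t i = view n' d' N' P' t' i'"
  shows "t = t'" "n = n'" "d = d'" "i = i'" "P i = P' i'"
  using assms by (cases t; cases t'; simp)+

lemma mset_some_list: "mset (SOME l. mset l = M) = M"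
  by (rule someI_ex) (rule ex_mset)

lemma view_nbrs:
  assumes "view n d N P (Suc t) i = view n d N' P' (Suc t) i'" "finite (N i)" "finite (N' i')"
  shows "view n d N P t ` N i = view n d N' P' t ` N' i'"
proof -
  have "(SOME l. mset l = image_mset (view n d N P t) (mset_set (N i))) =
      (SOME l. mset l = image_mset (view n d N' P' t) (mset_set (N' i')))"
    using assms(1) unfolding view.simps knowledge.inject list.inject by (elim conjE)
  then have "image_mset (view n d N P t) (mset_set (N i)) =
      image_mset (view n d N' P' t) (mset_set (N' i'))"
    by (metis mset_some_list)
  then have "set_mset (image_mset (view n d N P t) (mset_set (N i))) =
      set_mset (image_mset (view n d N' P' t) (mset_set (N' i')))"
    by simp
  then show ?thesis using assms(2,3) by simp
qed

lemma image_eq_agree: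
  assumes "f ` A = g ` B" "\<And>x y. f x = g y \<Longrightarrow> x = y"
  shows "A = B \<and> (\<forall>x\<in>A. f x = g x)"
proof -
  have "x \<in> B \<and> f x = g x" if x: "x \<in> A" for x
  proof -
    obtain y where y: "y \<in> B" "f x = g y" using imageI[OF x, of f] assms(1) by auto
    with assms(2)[OF y(2)] show ?thesis by simp
  qed
  moreover have "x \<in> A" if x: "x \<in> B" for x
  proof -
    obtain y where y: "y \<in> A" "g x = f y" using imageI[OF x, of g] assms(1)[symmetric] by auto
    with assms(2)[OF y(2)[symmetric]] show ?thesis by simp
  qed
  ultimately show ?thesis by blast
qed

text \<open>
  A view determines the labelled ball, although it is a tree: a vertex occurring several times in it
  is recognized by its identifier.
\<close>

lemma view_determines_ball:
  assumes fin: "\<And>j. finite (N j)" "\<And>j. finite (N' j)"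
    and eq: "view n d N P (Suc r) i = view n d N' P' (Suc r) i" and u: "u \<in> nball N r i"
  shows "N u = N' u \<and> P u = P' u"
  using eq u
proof (induction r arbitrary: i)
  case (0 i)
  have "N i = N' i \<and> (\<forall>w\<in>N i. view n d N P 0 w = view n d N' P' 0 w)"
    by (rule image_eq_agree[OF view_nbrs[OF 0(1) fin]]) (rule view_own(4))
  then show ?case using 0 view_own(5)[OF 0(1)] by simp
next
  case (Suc r i)
  have nbrs: "N i = N' i \<and> (\<forall>w\<in>N i. view n d N P (Suc r) w = view n d N' P' (Suc r) w)"
    by (rule image_eq_agree[OF view_nbrs[OF Suc.prems(1) fin]]) (rule view_own(4))
  then have Ni: "N i = N' i" by blast
  show ?case
  proof (cases "u = i")
    case True
    then show ?thesis using Ni view_own(5)[OF Suc.prems(1)] by simp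
  next
    case False
    then obtain w where "w \<in> N i" "u \<in> nball N r w" using Suc.prems(2) by (auto simp: nball.simps(2))
    then show ?thesis using Suc.IH[of w] nbrs by blast
  qed
qed

text \<open>The depth exceeds the locality radius by 1, since the neighborhoods of the vertices on
  the boundary of the ball must be visible. Finiteness matters because \<open>mset_set\<close> is
  empty on infinite sets.\<close>

definition is_view ::
  "'c knowledge \<Rightarrow> nat \<times> nat \<times> (nat \<Rightarrow> nat set) \<times> (nat \<Rightarrow> 'c set) \<times> nat \<Rightarrow> bool" where
  "is_view s = (\<lambda>(n, d, N, P, i). (\<forall>j. finite (N j)) \<and> s = view n d N P (Suc (rounds n d)) i)"

definition decide :: "'c knowledge \<Rightarrow> 'c answer option" where
  "decide s = (if \<exists>x. is_view s x
     then case SOME x. is_view s x of (n, d, N, P, i) \<Rightarrow> Some (solution n d N P i) else None)"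

text \<open>The instance picked by \<open>SOME\<close> need not be the actual one, but having the
  same view it agrees with it on the ball of radius \<open>rounds n d\<close>, which determines
  \<open>solution\<close>. At other times the round number does not fit.\<close>

lemma decide_view:
  assumes fin: "\<And>j. finite (N j)"
  shows "decide (view n d N P t i) = (if t = Suc (rounds n d) then Some (solution n d N P i) else None)"
proof (cases "\<exists>x. is_view (view n d N P t i) x")
  case True
  define x where "x = (SOME x. is_view (view n d N P t i) x)"
  obtain n' d' N' P' i' where x: "x = (n', d', N', P', i')" by (rule prod_cases5)
  have "is_view (view n d N P t i) x" unfolding x_def using True by (rule someI_ex)
  then have x': "\<And>j. finite (N' j)" "view n d N P t i = view n' d' N' P' (Suc (rounds n' d')) i'"
    by (auto simp: is_view_def x)
  note own = view_own[OF x'(2)]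
  have "view n d N P (Suc (rounds n d)) i = view n d N' P' (Suc (rounds n d)) i"
    using x'(2) own by simp
  then have "\<And>u. u \<in> nball N (rounds n d) i \<Longrightarrow> N u = N' u \<and> P u = P' u"
    using view_determines_ball[of N N'] fin x'(1) by blast
  then have "solution n d N P i = solution n d N' P' i"
    by (rule local_mapD[OF local_solution])
  moreover have "decide (view n d N P t i) = Some (solution n' d' N' P' i')"
    unfolding decide_def if_P[OF True] x_def[symmetric] x by simp
  ultimately show ?thesis using own by simp
next
  case False
  moreover have "is_view (view n d N P (Suc (rounds n d)) i) (n, d, N, P, i)"
    using fin by (simp add: is_view_def del: view.simps)
  ultimately have "t \<noteq> Suc (rounds n d)" by blast
  then show ?thesis using False by (simp add: decide_def)
qed

text \<open>A node keeps its header and replaces the list of views by the messages just received.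
  All states have a header, so the fallback case is never reached in a run.\<close>

definition gather :: "('c knowledge, 'c knowledge, 'c set, 'c answer) local_algorithm" where
  "gather = \<lparr>
     init = (\<lambda>i n d P. Tree [Number 0, Number n, Number d, Number i, Palette P]),
     message = (\<lambda>s. s),
     update = (\<lambda>s M. case s of
       Tree (Number t # x1 # x2 # x3 # x4 # _) \<Rightarrow>
         Tree (Number (Suc t) # x1 # x2 # x3 # x4 # (SOME l. mset l = M))
     | _ \<Rightarrow> s),
     decision = decide\<rparr>"

lemma gather_simps:
  "init gather i n d P = Tree [Number 0, Number n, Number d, Number i, Palette P]"
  "message gather s = s"
  "update gather (Tree (Number t # x1 # x2 # x3 # x4 # ms)) M =
     Tree (Number (Suc t) # x1 # x2 # x3 # x4 # (SOME l. mset l = M))"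
  "decision gather = decide"
  by (simp_all add: gather_def)

section \<open>Transfer from arbitrary graphs to graphs on identifiers\<close>

locale identified_graph = pair_graph G for G :: "'v pair_pre_digraph" +
  fixes ident :: "'v \<Rightarrow> nat" and L :: "'v \<Rightarrow> 'c set"
  assumes ids: "unique_identifiers G ident"
    and max3: "3 \<le> max_degree G"
    and lists: "list_assignment G (max_degree G) L"
begin

abbreviation "V \<equiv> pverts G"
abbreviation "n \<equiv> card V"
abbreviation "d \<equiv> max_degree G"

text \<open>The conjunct on \<open>i\<close> gives numbers that are not identifiers an empty
  neighborhood, as \<open>inv_into\<close> is arbitrary there.\<close>

definition N :: "nat \<Rightarrow> nat set" where
  "N i = ident ` {u. (inv_into V ident i, u) \<in> parcs G \<and> i \<in> ident ` V}"

definition P :: "nat \<Rightarrow> 'c set" where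
  "P i = L (inv_into V ident i)"

lemma inj: "inj_on ident V"
  using ids by (simp add: unique_identifiers_def)

lemma inv_ident [simp]: "v \<in> V \<Longrightarrow> inv_into V ident (ident v) = v"
  using inj by (rule inv_into_f_f)

lemma N_ident: "v \<in> V \<Longrightarrow> N (ident v) = ident ` {u. (v, u) \<in> parcs G}"
  by (auto simp: N_def)

lemma nbrs_sub: "{u. (v, u) \<in> parcs G} \<subseteq> V"
  using in_arcsD2 by blast

lemma N_sub: "N i \<subseteq> ident ` V"
  using nbrs_sub by (auto simp: N_def)

lemma card_nbrs_le: "v \<in> V \<Longrightarrow> card {u. (v, u) \<in> parcs G} \<le> d"
proof -
  assume v: "v \<in> V"
  have "{u. (v, u) \<in> parcs G} = snd ` out_arcs (with_proj G) v"
    by (force simp: out_arcs_def)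
  moreover have "finite (out_arcs (with_proj G) v)"
    using pair_finite_arcs by (simp add: out_arcs_def)
  ultimately have "card {u. (v, u) \<in> parcs G} \<le> out_degree (with_proj G) v"
    by (simp add: out_degree_def card_image_le)
  also have "\<dots> \<le> d" unfolding max_degree_def using v pair_finite_verts by (intro Max_ge) auto
  finally show ?thesis .
qed

sublocale inst: coloring_instance N "ident ` V" d P n
proof
  show "finite (ident ` V)" using pair_finite_verts by simp
  show "N i \<subseteq> ident ` V" for i by (rule N_sub)
  show "i \<in> N j" if "j \<in> N i" for i j
  proof -
    have "i \<in> ident ` V" using that by (auto simp: N_def)
    then obtain v where v: "v \<in> V" "i = ident v" by blast
    have "j \<in> ident ` {u. (v, u) \<in> parcs G}" using that N_ident[OF v(1)] v(2) by simp
    then obtain w where w: "j = ident w" "(v, w) \<in> parcs G" by auto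
    then have "w \<in> V" by (auto dest: in_arcsD2)
    then show ?thesis using v w arcs_symmetric N_ident by auto
  qed
  show "i \<notin> N i" for i
  proof
    assume i: "i \<in> N i"
    then obtain v where v: "v \<in> V" "i = ident v" using N_sub by blast
    then obtain w where w: "(v, w) \<in> parcs G" "ident v = ident w" using i N_ident by auto
    then have "v = w" using inj v in_arcsD2 by (auto dest: inj_onD)
    then show False using w no_loops' by blast
  qed
  show "card (N i) \<le> d" for i
  proof (cases "i \<in> ident ` V")
    case True
    then obtain v where v: "v \<in> V" "i = ident v" by blast
    have "card (N i) \<le> card {u. (v, u) \<in> parcs G}"
      unfolding v(2) N_ident[OF v(1)]
      by (rule card_image_le) (use nbrs_sub pair_finite_verts finite_subset in blast)
    then show ?thesis using card_nbrs_le[OF v(1)] by simp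
  qed (simp add: N_def)
  show "3 \<le> d" by (rule max3)
  show "n = card (ident ` V)" using inj by (simp add: card_image)
  show "i \<le> n" if "i \<in> ident ` V" for i
    using ids that by (auto simp: unique_identifiers_def)
  show "infinite (P i) \<or> d \<le> card (P i)" if "i \<in> ident ` V" for i
    using lists that by (auto simp: P_def list_assignment_def)
qed

lemma node_state_view: "v \<in> V \<Longrightarrow> node_state gather G ident L t v = view n d N P t (ident v)"
proof (induction t arbitrary: v)
  case 0
  then show ?case by (simp add: gather_simps P_def)
next
  case (Suc t)
  let ?A = "{u. (v, u) \<in> parcs G}"
  have finA: "finite ?A" using nbrs_sub pair_finite_verts finite_subset by blast
  have "inj_on ident ?A" using inj nbrs_sub inj_on_subset by blast
  then have "mset_set (N (ident v)) = image_mset ident (mset_set ?A)"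
    using Suc.prems by (simp add: N_ident image_mset_mset_set)
  then have "image_mset (view n d N P t) (mset_set (N (ident v))) =
      image_mset (\<lambda>u. view n d N P t (ident u)) (mset_set ?A)"
    by (simp add: image_mset.compositionality comp_def)
  also have "\<dots> = image_mset (\<lambda>u. message gather (node_state gather G ident L t u)) (mset_set ?A)"
  proof (rule image_mset_cong)
    fix u assume "u \<in># mset_set ?A"
    then have "u \<in> V" using nbrs_sub finA by auto
    then show "view n d N P t (ident u) = message gather (node_state gather G ident L t u)"
      by (simp add: Suc.IH gather_simps)
  qed
  finally have msgs: "image_mset (\<lambda>u. message gather (node_state gather G ident L t u)) (mset_set ?A) =
      image_mset (view n d N P t) (mset_set (N (ident v)))" by simp
  show ?case
    unfolding node_state.simps msgs Suc.IH[OF Suc.prems]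
    by (cases t) (simp_all add: gather_simps)
qed

lemma decision_view:
  "v \<in> V \<Longrightarrow> decision gather (node_state gather G ident L t v) =
    (if t = Suc (rounds n d) then Some (solution n d N P (ident v)) else None)"
  using decide_view[OF inst.finN] by (simp only: node_state_view gather_simps)

lemma decided: "all_decided_within gather G ident L (Suc (rounds n d))"
  unfolding all_decided_within_def
proof (intro ballI exI[of _ "Suc (rounds n d)"] conjI)
  fix v assume "v \<in> V"
  then show "decision gather (node_state gather G ident L (Suc (rounds n d)) v) \<noteq> None"
    by (simp add: decision_view del: node_state.simps)
qed simp

lemma node_output_eq: "v \<in> V \<Longrightarrow> node_output gather G ident L v = solution n d N P (ident v)"
proof -
  assume v: "v \<in> V"
  have "(LEAST t. decision gather (node_state gather G ident L t v) \<noteq> None) = Suc (rounds n d)"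
    by (rule Least_equality) (auto simp: decision_view[OF v] simp del: node_state.simps split: if_splits)
  then show ?thesis by (simp add: node_output_def decision_view[OF v] del: node_state.simps)
qed

lemma list_coloring_iff:
  "list_coloring G L (\<lambda>v. f (ident v)) \<longleftrightarrow>
    (\<forall>i\<in>ident ` V. f i \<in> P i \<and> (\<forall>j\<in>N i. f i \<noteq> f j))"
  using in_arcsD1 by (fastforce simp: list_coloring_def proper_coloring_def P_def N_ident)

lemma list_coloring_exists_iff:
  "(\<exists>c. list_coloring G L c) \<longleftrightarrow> (\<exists>f. \<forall>i\<in>ident ` V. f i \<in> P i \<and> (\<forall>j\<in>N i. f i \<noteq> f j))"
proof
  assume "\<exists>c. list_coloring G L c"
  then obtain c where c: "list_coloring G L c" by blast
  have "list_coloring G L (\<lambda>v. (c \<circ> inv_into V ident) (ident v))"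
    using c in_arcsD1 in_arcsD2 by (force simp: list_coloring_def proper_coloring_def)
  then show "\<exists>f. \<forall>i\<in>ident ` V. f i \<in> P i \<and> (\<forall>j\<in>N i. f i \<noteq> f j)"
    unfolding list_coloring_iff by blast
qed (use list_coloring_iff in blast)

lemma solves: "solves_list_coloring G L (node_output gather G ident L)"
  using inst.solution_correct
proof (elim disjE conjE bexE exE)
  fix f assume f: "\<forall>i\<in>ident ` V. solution n d N P i = Color (f i) \<and> f i \<in> P i \<and> (\<forall>j\<in>N i. f i \<noteq> f j)"
  then have "list_coloring G L (\<lambda>v. f (ident v))" using list_coloring_iff by blast
  moreover have "\<forall>v\<in>V. node_output gather G ident L v = Color (f (ident v))" using f node_output_eq by auto
  ultimately show ?thesis unfolding solves_list_coloring_def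
    by (intro disjI1 exI[of _ "\<lambda>v. f (ident v)"]) auto
next
  fix i B
  assume none: "\<nexists>f. \<forall>i\<in>ident ` V. f i \<in> P i \<and> (\<forall>j\<in>N i. f i \<noteq> f j)"
    and i: "i \<in> ident ` V" "i \<in> B"
    and B: "\<forall>j\<in>B. N j \<subseteq> B \<and> solution n d N P j = No_Coloring"
  from i obtain v where v: "v \<in> V" "i = ident v" by blast
  have reach: "u \<in> V \<and> ident u \<in> B" if "v \<rightarrow>\<^sup>*\<^bsub>with_proj G\<^esub> u" for u
    using that
  proof (induction rule: reachable_induct)
    case base
    then show ?case using v i by simp
  next
    case (step x y)
    then have "(x, y) \<in> parcs G" by simp
    with step B N_ident in_arcsD2 show ?case by blast
  qed
  then have "node_output gather G ident L u = No_Coloring" if "v \<rightarrow>\<^sup>*\<^bsub>with_proj G\<^esub> u" for u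
    using that node_output_eq B by auto
  then show ?thesis
    using none list_coloring_exists_iff v unfolding solves_list_coloring_def by blast
qed

end

section \<open>Explicit bound on the number of rounds\<close>

lemma bits_le:
  assumes "4 \<le> n"
  shows "real (bits n) \<le> 3 * ln (real n)" "1 \<le> ln (real n)" "1 \<le> bits n"
proof -
  have "exp 1 \<le> (2 * 2 :: real)" using exp_le by linarith
  then have "1 \<le> ln (2 * 2 :: real)" by (subst ln_ge_iff) auto
  moreover have "ln (2 * 2 :: real) \<le> ln (real n)" using assms by (subst ln_le_cancel_iff) auto
  ultimately show ln1: "1 \<le> ln (real n)" by linarith
  have "ln (2 * 2 :: real) = ln 2 + ln 2" by (rule ln_mult_pos) simp_all
  with \<open>1 \<le> ln (2 * 2 :: real)\<close> have ln2: "1 / 2 \<le> ln (2 :: real)" by linarith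
  show pos: "1 \<le> bits n"
    using less_two_pow_bits[of n] assms by (cases "bits n") auto
  then obtain k where k: "bits n = Suc k" by (cases "bits n") auto
  \<comment> \<open>Minimality of \<open>bits n\<close> gives \<open>2 ^ k <= n\<close>, so
    \<open>k <= 2 * ln n\<close> as \<open>ln 2 >= 1 / 2\<close>; the remaining 1 is at most
    \<open>ln n\<close>, which explains the factor 3.\<close>
  then have "\<not> n < 2 ^ k" using not_less_Least[of k "\<lambda>m. n < 2 ^ m"] by (simp add: bits_def)
  then have "2 ^ k \<le> real n" by (metis not_less of_nat_le_iff of_nat_numeral of_nat_power)
  then have "ln (2 ^ k) \<le> ln (real n)" using assms by (subst ln_le_cancel_iff) auto
  then have "real k * ln 2 \<le> ln (real n)" by (simp add: ln_realpow)
  moreover have "real k * (1 / 2) \<le> real k * ln 2" using ln2 by (intro mult_left_mono) auto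
  ultimately show "real (bits n) \<le> 3 * ln (real n)" using k ln1 by simp
qed

lemma rounds_le:
  assumes "1 \<le> bits n" "1 \<le> d"
  shows "Suc (rounds n d) \<le> 40 * (bits n)\<^sup>2 * d"
proof -
  define m where "m = bits n"
  obtain k where k: "m = Suc k" using assms(1) by (cases "bits n") (auto simp: m_def)
  obtain e where e: "d = Suc e" using assms(2) by (cases d) auto
  have "Suc (rounds n d) = 2 * m * Suc d + 2 * (m * (4 * m + 3)) + m * (4 * m + 3) * Suc d + (4 * m + 4)"
    by (simp add: rounds_def domination_def separation_def repair_radius_def m_def algebra_simps)
  \<comment> \<open>In \<open>k\<close> and \<open>e\<close> both sides are polynomials whose
    coefficients compare one by one; for \<open>m = d = 1\<close> both equal 40.\<close>
  also have "\<dots> \<le> 40 * m\<^sup>2 * d"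
    unfolding k e by (simp add: algebra_simps power2_eq_square)
  finally show ?thesis by (simp add: m_def)
qed

text \<open>The count is of order \<open>d * ln n ^ 2\<close>; as \<open>d\<close> and
  \<open>ln n\<close> are at least 1, one more factor of each may be added. The constant is
  \<open>40 * 3 ^ 2\<close>.\<close>

lemma rounds_bound:
  assumes "4 \<le> n" "1 \<le> d"
  shows "real (Suc (rounds n d)) \<le> 360 * real d ^ 2 * ln (real n) ^ 3"
proof -
  let ?l = "ln (real n)"
  have "real (Suc (rounds n d)) \<le> real (40 * (bits n)\<^sup>2 * d)"
    using rounds_le[OF bits_le(3)[OF assms(1)] assms(2)] by (rule of_nat_mono)
  also have "\<dots> = 40 * (real (bits n))\<^sup>2 * real d" by simp
  also have "\<dots> \<le> 40 * (3 * ?l)\<^sup>2 * real d"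
    using bits_le(1)[OF assms(1)] by (intro mult_mono power_mono) auto
  also have "\<dots> = 360 * (?l\<^sup>2 * real d)" by (simp add: power2_eq_square)
  also have "\<dots> \<le> 360 * (?l ^ 3 * real d ^ 2)"
    using bits_le(2)[OF assms(1)] assms(2) power_increasing[of 2 3 ?l] power_increasing[of 1 2 "real d"]
    by (intro mult_left_mono mult_mono) auto
  finally show ?thesis by (simp add: mult.commute mult.left_commute)
qed

theorem corollary2p1:
  shows "\<exists>(A :: ('c knowledge, 'c knowledge, 'c set, 'c answer) local_algorithm) (C :: real).
    \<forall>(G :: 'v pair_pre_digraph) (ident :: 'v \<Rightarrow> nat) (L :: 'v \<Rightarrow> 'c set) (n :: nat) (\<Delta> :: nat).
      pair_graph G \<and> n = card (pverts G) \<and> unique_identifiers G ident \<and>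
      \<Delta> = max_degree G \<and> \<Delta> \<ge> 3 \<and> list_assignment G \<Delta> L \<longrightarrow>
        (\<exists>r :: nat. real r \<le> C * real \<Delta> ^ 2 * ln (real n) ^ 3 \<and>
           all_decided_within A G ident L r) \<and>
        solves_list_coloring G L (node_output A G ident L)"
proof (intro exI[of _ gather] exI[of _ 360] allI impI)
  fix G :: "'v pair_pre_digraph" and ident :: "'v \<Rightarrow> nat" and L :: "'v \<Rightarrow> 'c set" and n \<Delta> :: nat
  assume asm: "pair_graph G \<and> n = card (pverts G) \<and> unique_identifiers G ident \<and>
      \<Delta> = max_degree G \<and> \<Delta> \<ge> 3 \<and> list_assignment G \<Delta> L"
  then interpret pair_graph G by blast
  interpret identified_graph G ident L
    using asm by unfold_locales auto
  have "\<exists>r :: nat. real r \<le> 360 * real \<Delta> ^ 2 * ln (real n) ^ 3 \<and> all_decided_within gather G ident L r"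
  \<comment> \<open>On the empty graph the maximum degree is a \<open>Max\<close> of the empty set,
    but 0 rounds suffice there and the bound is 0, as \<open>ln 0 = 0\<close>.\<close>
  proof (cases "pverts G = {}")
    case True
    then show ?thesis using asm by (intro exI[of _ 0]) (simp add: all_decided_within_def)
  next
    case False
    then have "max_degree G \<in> out_degree (with_proj G) ` pverts G"
      unfolding max_degree_def using pair_finite_verts by (intro Max_in) auto
    then obtain v where v: "v \<in> pverts G" "max_degree G = out_degree (with_proj G) v" by blast
    \<comment> \<open>Degrees are at most \<open>n - 1\<close>, so \<open>\<Delta> \<ge> 3\<close>
      gives the \<open>n \<ge> 4\<close> that \<open>rounds_bound\<close> asks for.\<close>
    have "out_arcs (with_proj G) v \<subseteq> {v} \<times> (pverts G - {v})"
      by (auto simp: out_arcs_def dest: in_arcsD2 no_loops')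
    then have "max_degree G \<le> card ({v} \<times> (pverts G - {v}))"
      unfolding v(2) out_degree_def using pair_finite_verts by (intro card_mono) auto
    then have "\<Delta> \<le> n - 1" using asm v(1) pair_finite_verts by (simp add: card_cartesian_product)
    then have "4 \<le> n" "1 \<le> \<Delta>" using asm by auto
    then have "real (Suc (rounds n \<Delta>)) \<le> 360 * real \<Delta> ^ 2 * ln (real n) ^ 3"
      by (rule rounds_bound)
    moreover have "all_decided_within gather G ident L (Suc (rounds n \<Delta>))"
      using decided asm by simp
    ultimately show ?thesis by blast
  qed
  then show "(\<exists>r :: nat. real r \<le> 360 * real \<Delta> ^ 2 * ln (real n) ^ 3 \<and>
           all_decided_within gather G ident L r) \<and>
        solves_list_coloring G L (node_output gather G ident L)"
    using solves by blast
qed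

end
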